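(* (Convergence for $d=2$.) Let $\{I^k_{i,j,n}\}$ be defined by the two-dimensional upwind scheme (S) described in the context. Suppose that the discretization parameters satisfy $$\frac{c^+\Delta t}{\Delta x_1}+\frac{c^+\Delta t}{\Delta x_2}\le 1\qquad\text{and}\qquad \left\|\frac{\partial^2\tilde p}{\partial\alpha^2}\right\|_\infty\Delta\theta^2\le\frac{12}{\pi}\mu^*,$$ and in addition: (i) the mesh ratios $\Delta t/\Delta x_1$ and $\Delta t/\Delta x_2$ are kept fixed; (ii) there exist positive numbers $\mu_{\rm a}^+$ and $\mu_{\rm s}^+$ such that $0\le\mu_{\rm a}(x)\le\mu_{\rm a}^+$ and $0\le\mu_{\rm s}(x)\le\mu_{\rm s}^+$ for $x\in\Omega$; (iii) the solution $I(t,x,\xi)$ of the initial-boundary value problem (P) described in the context belongs to $C^2\bigl([0,T)\times(X\cup\Gamma_-)\bigr)$ and is bounded together with its derivatives of the first and the second order. Then $$\|I(t_k,\cdot,\cdot)-I^k\|_\infty\le C(\Delta t+\Delta\theta^2),\qquad 0\le k\le T/\Delta t,$$ where $C$ is a positive number independent of $\Delta t$ and $\Delta\theta$, and $\|I(t_k,\cdot,\cdot)-I^k\|_\infty:=\sup\{|I(t_k,x_{ij},\xi_n)-I^k_{i,j,n}|:\ (x_{ij},\xi_n)\in X\cup\Gamma_-\}$.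
   Context: Domain and data. Let $T>0$, $\Omega=(0,L_1)\times(0,L_2)\subset\mathbb{R}^2$, $X=\Omega\times S^1$, and $\Gamma_-=\{(x,\xi)\in\partial\Omega\times S^1:\ n(x)\cdot\xi<0\}$, where $n(x)$ is the outward unit normal at $x\in\partial\Omega$ (undefined at the four corners, which are not part of $\Gamma_-$ and do not enter the scheme). The functions $c,\mu_{\rm a},\mu_{\rm s}$ on $\Omega$ are measurable with $c(x)>0$, $\mu_{\rm a}(x)\ge0$, $\mu_{\rm s}(x)\ge0$, $\mu_{\rm s}\not\equiv0$, and $$c^+:=\sup_{x\in\Omega}c(x)<\infty,\qquad \mu^*:=\inf_{\{x:\ \mu_{\rm s}(x)\ne0\}}\frac{\mu_{\rm a}(x)}{\mu_{\rm s}(x)}>0.$$ The scattering kernel is $p(x;\xi,\xi')=\tilde p(x;\alpha)$, where $\alpha$ is the angle formed by $\xi,\xi'\in S^1$, and $\tilde p(x;\alpha)\ge0$ is, for each $x\in\Omega$, $2\pi$-periodic, even and of class $C^2$ in $\alpha$, with $\int_0^{2\pi}\tilde p(x;\alpha)\,d\alpha=1$ and $$\left\|\frac{\partial^2\tilde p}{\partial\alpha^2}\right\|_\infty:=\sup_{(x,\alpha)\in\Omega\times[0,2\pi]}\left|\frac{\partial^2\tilde p}{\partial\alpha^2}(x;\alpha)\right|<\infty.$$ The inputs $q(t,x,\xi)$ (for $(x,\xi)\in X$), $I_0(x,\xi)$ (for $(x,\xi)\in X$) and $I_1(t,x,\xi)$ (for $(x,\xi)\in\Gamma_-$) are real bounded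 measurable functions. Problem (P). $$\frac{1}{c(x)}\frac{\partial I}{\partial t}=-\xi\cdot\nabla_xI-\{\mu_{\rm a}(x)+\mu_{\rm s}(x)\}I+\mu_{\rm s}(x)\int_{S^1}p(x;\xi,\xi')I(t,x,\xi')\,d\omega_{\xi'}+q(t,x,\xi),\quad 0<t<T,\ (x,\xi)\in X,$$ $$I(0,x,\xi)=I_0(x,\xi),\ (x,\xi)\in X;\qquad I(t,x,\xi)=I_1(t,x,\xi),\ 0<t<T,\ (x,\xi)\in\Gamma_-,$$ where $d\omega_{\xi'}$ is the arc-length element on $S^1$. The equation and the boundary condition are understood to hold also at the endpoint times at which the scheme evaluates $q$ and $I_1$ ($t=0$, and $t=T$ for $I_1$ if $T/\Delta t$ is an integer), with $I(T,\cdot,\cdot)$ being the continuous extension in $t$ of $I$. Grid. For positive integers $M_1,M_2,M$ and $\Delta t>0$ put $\Delta x_1=L_1/M_1$, $\Delta x_2=L_2/M_2$, $\Delta\theta=2\pi/M$, $t_k=k\Delta t$, $x_{ij}=(i\Delta x_1,j\Delta x_2)$, $\xi_n=(\xi_{n,1},\xi_{n,2})=(\cos n\Delta\theta,\sin n\Delta\theta)$ for integers $k,i,j,n$ (with $n$ understood modulo $M$). Scheme (S). The numbers $I^k_{i,j,n}$ are determined by $$\frac{1}{c(x_{ij})}\frac{I^{k+1}_{i,j,n}-I^k_{i,j,n}}{\Delta t}=A_\Delta I^k_{i,j,n}-\Sigma_\Delta I^{k+1}_{i,j,n}+K_\Delta I^k_{i,j,n}+q(t_k,x_{ij},\xi_n),\quad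 0\le k\le T/\Delta t-1,\ (x_{ij},\xi_n)\in X,$$ $$I^0_{i,j,n}=I_0(x_{ij},\xi_n),\quad (x_{ij},\xi_n)\in X;\qquad I^k_{i,j,n}=I_1(t_k,x_{ij},\xi_n),\quad 0\le k\le T/\Delta t,\ (x_{ij},\xi_n)\in\Gamma_-,$$ where $$A_\Delta I^k_{i,j,n}=-\xi_{n,1}\frac{I^k_{i+1,j,n}-I^k_{i-1,j,n}}{2\Delta x_1}+|\xi_{n,1}|\frac{I^k_{i+1,j,n}-2I^k_{i,j,n}+I^k_{i-1,j,n}}{2\Delta x_1}-\xi_{n,2}\frac{I^k_{i,j+1,n}-I^k_{i,j-1,n}}{2\Delta x_2}+|\xi_{n,2}|\frac{I^k_{i,j+1,n}-2I^k_{i,j,n}+I^k_{i,j-1,n}}{2\Delta x_2},$$ $$\Sigma_\Delta I^k_{i,j,n}=\{\mu_{\rm s}(x_{ij})+\mu_{\rm a}(x_{ij})\}I^k_{i,j,n},\qquad K_\Delta I^k_{i,j,n}=\mu_{\rm s}(x_{ij})\Delta\theta\sum_{\nu=0}^{M-1}p(x_{ij};\xi_n,\xi_\nu)I^k_{i,j,\nu}.$$ In $A_\Delta$, values at grid points outside $X\cup\Gamma_-$ occur only with total coefficient $0$ and are disregarded. *)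

theory Defs
  imports "HOL-Analysis.Analysis"
begin

section \<open>Domain\<close>

definition rect :: "real \<Rightarrow> real \<Rightarrow> (real \<times> real) set" where
  "rect L1 L2 = {0<..<L1} \<times> {0<..<L2}"

definition phase_space :: "real \<Rightarrow> real \<Rightarrow> ((real \<times> real) \<times> (real \<times> real)) set" where
  "phase_space L1 L2 = rect L1 L2 \<times> sphere 0 1"

definition corners :: "real \<Rightarrow> real \<Rightarrow> (real \<times> real) set" where
  "corners L1 L2 = {0, L1} \<times> {0, L2}"

text \<open>Only meaningful on the boundary of the rectangle without its corners.\<close>
definition outward_normal :: "real \<Rightarrow> real \<Rightarrow> real \<times> real \<Rightarrow> real \<times> real" where
  "outward_normal L1 L2 x =
     (if fst x = 0 then (-1, 0)
      else if fst x = L1 then (1, 0)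
      else if snd x = 0 then (0, -1)
      else (0, 1))"

definition inflow_boundary :: "real \<Rightarrow> real \<Rightarrow> ((real \<times> real) \<times> (real \<times> real)) set" where
  "inflow_boundary L1 L2 =
     {(x, \<xi>). x \<in> frontier (rect L1 L2) - corners L1 L2 \<and> \<xi> \<in> sphere 0 1 \<and>
             outward_normal L1 L2 x \<bullet> \<xi> < 0}"

section \<open>Directions and scattering\<close>

definition dir :: "real \<Rightarrow> real \<times> real" where
  "dir \<theta> = (cos \<theta>, sin \<theta>)"

text \<open>Integration over the unit circle with respect to arc length.\<close>
definition circle_integral :: "(real \<times> real \<Rightarrow> real) \<Rightarrow> real" where
  "circle_integral f = integral {0..2 * pi} (\<lambda>\<theta>. f (dir \<theta>))"

text \<open>For unit vectors the argument of \<open>pt x\<close> is the angle in \<open>[0, \<pi>]\<close> between them; since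
  \<open>pt x\<close> is even and \<open>2\<pi>\<close>-periodic, the choice of representative of the angle is immaterial.\<close>
definition kernel ::
  "(real \<times> real \<Rightarrow> real \<Rightarrow> real) \<Rightarrow> real \<times> real \<Rightarrow> real \<times> real \<Rightarrow> real \<times> real \<Rightarrow> real" where
  "kernel pt x \<xi> \<xi>' = pt x (arccos (\<xi> \<bullet> \<xi>'))"

definition C2_real :: "(real \<Rightarrow> real) \<Rightarrow> bool" where
  "C2_real f \<longleftrightarrow>
     (\<forall>\<alpha>. f differentiable (at \<alpha>)) \<and> (\<forall>\<alpha>. deriv f differentiable (at \<alpha>)) \<and>
     continuous_on UNIV (deriv (deriv f))"

definition scattering_kernel :: "(real \<times> real) set \<Rightarrow> (real \<times> real \<Rightarrow> real \<Rightarrow> real) \<Rightarrow> bool" where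
  "scattering_kernel \<Omega> pt \<longleftrightarrow>
     (\<forall>x\<in>\<Omega>. (\<forall>\<alpha>. pt x \<alpha> \<ge> 0) \<and> (\<forall>\<alpha>. pt x (\<alpha> + 2 * pi) = pt x \<alpha>) \<and>
            (\<forall>\<alpha>. pt x (- \<alpha>) = pt x \<alpha>) \<and> C2_real (pt x) \<and>
            integral {0..2 * pi} (pt x) = 1) \<and>
     bdd_above ((\<lambda>(x, \<alpha>). \<bar>deriv (deriv (pt x)) \<alpha>\<bar>) ` (\<Omega> \<times> {0..2 * pi}))"

definition kernel_norm2 :: "(real \<times> real) set \<Rightarrow> (real \<times> real \<Rightarrow> real \<Rightarrow> real) \<Rightarrow> real" where
  "kernel_norm2 \<Omega> pt = (SUP (x, \<alpha>) \<in> \<Omega> \<times> {0..2 * pi}. \<bar>deriv (deriv (pt x)) \<alpha>\<bar>)"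

definition absorption_ratio ::
  "(real \<times> real) set \<Rightarrow> (real \<times> real \<Rightarrow> real) \<Rightarrow> (real \<times> real \<Rightarrow> real) \<Rightarrow> real" where
  "absorption_ratio \<Omega> \<mu>a \<mu>s = (INF x \<in> {x \<in> \<Omega>. \<mu>s x \<noteq> 0}. \<mu>a x / \<mu>s x)"

section \<open>Bounded measurable inputs\<close>

text \<open>Functions on the circle are measured through the angle. On the boundary, each of the four
  sides of the rectangle is parametrised by arc length.\<close>

definition admissible_source ::
  "real \<Rightarrow> real \<Rightarrow> real \<Rightarrow> (real \<Rightarrow> real \<times> real \<Rightarrow> real \<times> real \<Rightarrow> real) \<Rightarrow> bool" where
  "admissible_source T L1 L2 q \<longleftrightarrow>
     (\<lambda>(t, x, \<theta>). q t x (dir \<theta>)) \<in> borel_measurable (lebesgue_on ({0..<T} \<times> rect L1 L2 \<times> UNIV)) \<and>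
     bounded ((\<lambda>(t, x, \<xi>). q t x \<xi>) ` ({0..<T} \<times> phase_space L1 L2))"

definition admissible_initial ::
  "real \<Rightarrow> real \<Rightarrow> (real \<times> real \<Rightarrow> real \<times> real \<Rightarrow> real) \<Rightarrow> bool" where
  "admissible_initial L1 L2 I0 \<longleftrightarrow>
     (\<lambda>(x, \<theta>). I0 x (dir \<theta>)) \<in> borel_measurable (lebesgue_on (rect L1 L2 \<times> UNIV)) \<and>
     bounded ((\<lambda>(x, \<xi>). I0 x \<xi>) ` phase_space L1 L2)"

definition admissible_inflow ::
  "real \<Rightarrow> real \<Rightarrow> real \<Rightarrow> (real \<Rightarrow> real \<times> real \<Rightarrow> real \<times> real \<Rightarrow> real) \<Rightarrow> bool" where
  "admissible_inflow T L1 L2 I1 \<longleftrightarrow>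
     (\<forall>\<gamma> \<in> {\<lambda>s. (0, s), \<lambda>s. (L1, s), \<lambda>s. (s, 0), \<lambda>s. (s, L2)}.
        (\<lambda>(t, s, \<theta>). I1 t (\<gamma> s) (dir \<theta>)) \<in> borel_measurable
          (lebesgue_on {(t, s, \<theta>). t \<in> {0..T} \<and> (\<gamma> s, dir \<theta>) \<in> inflow_boundary L1 L2})) \<and>
     bounded ((\<lambda>(t, x, \<xi>). I1 t x \<xi>) ` ({0..T} \<times> inflow_boundary L1 L2))"

section \<open>The initial-boundary value problem\<close>

text \<open>The equation is imposed for \<open>0 \<le> t < T\<close>, the time derivative at \<open>t = 0\<close> being one-sided,
  and \<open>I T\<close> is the continuous extension in time. The boundary condition at \<open>t = T\<close> is not
  included here, because it is needed only for those step sizes for which the scheme evaluates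
  the boundary data at \<open>t = T\<close>.\<close>
definition solves_P ::
  "real \<Rightarrow> real \<Rightarrow> real \<Rightarrow> (real \<times> real \<Rightarrow> real) \<Rightarrow> (real \<times> real \<Rightarrow> real) \<Rightarrow> (real \<times> real \<Rightarrow> real) \<Rightarrow>
   (real \<times> real \<Rightarrow> real \<Rightarrow> real) \<Rightarrow> (real \<Rightarrow> real \<times> real \<Rightarrow> real \<times> real \<Rightarrow> real) \<Rightarrow>
   (real \<times> real \<Rightarrow> real \<times> real \<Rightarrow> real) \<Rightarrow> (real \<Rightarrow> real \<times> real \<Rightarrow> real \<times> real \<Rightarrow> real) \<Rightarrow>
   (real \<Rightarrow> real \<times> real \<Rightarrow> real \<times> real \<Rightarrow> real) \<Rightarrow> bool" where
  "solves_P T L1 L2 c \<mu>a \<mu>s pt q I0 I1 I \<longleftrightarrow>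
     (\<forall>t\<in>{0..<T}. \<forall>(x, \<xi>)\<in>phase_space L1 L2. \<exists>It G.
        ((\<lambda>s. I s x \<xi>) has_real_derivative It) (at t within {0..<T}) \<and>
        GDERIV (\<lambda>y. I t y \<xi>) x :> G \<and>
        1 / c x * It =
          - (\<xi> \<bullet> G) - (\<mu>a x + \<mu>s x) * I t x \<xi>
          + \<mu>s x * circle_integral (\<lambda>\<xi>'. kernel pt x \<xi> \<xi>' * I t x \<xi>') + q t x \<xi>) \<and>
     (\<forall>(x, \<xi>)\<in>phase_space L1 L2. I 0 x \<xi> = I0 x \<xi>) \<and>
     (\<forall>t\<in>{0..<T}. \<forall>(x, \<xi>)\<in>inflow_boundary L1 L2. I t x \<xi> = I1 t x \<xi>) \<and>
     (\<forall>(x, \<xi>)\<in>phase_space L1 L2 \<union> inflow_boundary L1 L2.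
        ((\<lambda>t. I t x \<xi>) \<longlongrightarrow> I T x \<xi>) (at_left T))"

text \<open>Derivatives are taken within \<open>S\<close>, hence one-sided at points of \<open>S\<close> on its boundary.\<close>
definition bounded_C2_on :: "'a::real_normed_vector set \<Rightarrow> ('a \<Rightarrow> real) \<Rightarrow> bool" where
  "bounded_C2_on S f \<longleftrightarrow>
     (\<exists>(f' :: 'a \<Rightarrow> 'a \<Rightarrow>\<^sub>L real) (f'' :: 'a \<Rightarrow> 'a \<Rightarrow>\<^sub>L 'a \<Rightarrow>\<^sub>L real).
        (\<forall>z\<in>S. (f has_derivative blinfun_apply (f' z)) (at z within S)) \<and>
        (\<forall>z\<in>S. (f' has_derivative blinfun_apply (f'' z)) (at z within S)) \<and>
        continuous_on S f'' \<and>
        bounded (f ` S) \<and> bounded (f' ` S) \<and> bounded (f'' ` S))"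

text \<open>The class of bounded \<open>C\<^sup>2\<close> functions on \<open>[0, T) \<times> (X \<union> \<Gamma>\<^sub>-)\<close>, with the angle as (periodic)
  coordinate on the circle. Near each of its points, the coordinate set is convex with nonempty
  interior, so the derivatives within it are unique.\<close>
definition bounded_C2_solution ::
  "real \<Rightarrow> real \<Rightarrow> real \<Rightarrow> (real \<Rightarrow> real \<times> real \<Rightarrow> real \<times> real \<Rightarrow> real) \<Rightarrow> bool" where
  "bounded_C2_solution T L1 L2 I \<longleftrightarrow>
     bounded_C2_on
       {(t, x, \<theta>). t \<in> {0..<T} \<and> (x, dir \<theta>) \<in> phase_space L1 L2 \<union> inflow_boundary L1 L2}
       (\<lambda>(t, x, \<theta>). I t x (dir \<theta>))"

section \<open>Grid and upwind scheme\<close>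

text \<open>Grid functions have arguments \<open>i j n\<close>, preceded by the time index \<open>k\<close> where applicable.\<close>

definition grid_point :: "real \<Rightarrow> real \<Rightarrow> int \<Rightarrow> int \<Rightarrow> real \<times> real" where
  "grid_point dx1 dx2 i j = (of_int i * dx1, of_int j * dx2)"

definition grid_dir :: "nat \<Rightarrow> int \<Rightarrow> real \<times> real" where
  "grid_dir M n = dir (of_int n * (2 * pi / real M))"

definition A_grid ::
  "real \<Rightarrow> real \<Rightarrow> nat \<Rightarrow> (int \<Rightarrow> int \<Rightarrow> int \<Rightarrow> real) \<Rightarrow> int \<Rightarrow> int \<Rightarrow> int \<Rightarrow> real" where
  "A_grid dx1 dx2 M v i j n =
     (let \<xi> = grid_dir M n in
      - fst \<xi> * ((v (i + 1) j n - v (i - 1) j n) / (2 * dx1))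
      + \<bar>fst \<xi>\<bar> * ((v (i + 1) j n - 2 * v i j n + v (i - 1) j n) / (2 * dx1))
      - snd \<xi> * ((v i (j + 1) n - v i (j - 1) n) / (2 * dx2))
      + \<bar>snd \<xi>\<bar> * ((v i (j + 1) n - 2 * v i j n + v i (j - 1) n) / (2 * dx2)))"

definition Sigma_grid ::
  "real \<Rightarrow> real \<Rightarrow> (real \<times> real \<Rightarrow> real) \<Rightarrow> (real \<times> real \<Rightarrow> real) \<Rightarrow>
   (int \<Rightarrow> int \<Rightarrow> int \<Rightarrow> real) \<Rightarrow> int \<Rightarrow> int \<Rightarrow> int \<Rightarrow> real" where
  "Sigma_grid dx1 dx2 \<mu>a \<mu>s v i j n =
     (\<mu>s (grid_point dx1 dx2 i j) + \<mu>a (grid_point dx1 dx2 i j)) * v i j n"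

definition K_grid ::
  "real \<Rightarrow> real \<Rightarrow> nat \<Rightarrow> (real \<times> real \<Rightarrow> real) \<Rightarrow> (real \<times> real \<Rightarrow> real \<Rightarrow> real) \<Rightarrow>
   (int \<Rightarrow> int \<Rightarrow> int \<Rightarrow> real) \<Rightarrow> int \<Rightarrow> int \<Rightarrow> int \<Rightarrow> real" where
  "K_grid dx1 dx2 M \<mu>s pt v i j n =
     (let x = grid_point dx1 dx2 i j in
      \<mu>s x * (2 * pi / real M) *
      (\<Sum>\<nu>\<in>{0..<int M}. kernel pt x (grid_dir M n) (grid_dir M \<nu>) * v i j \<nu>))"

text \<open>All integers \<open>n\<close> are admitted; since the data depend on \<open>n\<close> only modulo \<open>M\<close>, so do the
  values determined by the scheme. At points of \<open>\<partial>\<Omega> \<times> S\<^sup>1\<close> outside the inflow boundary, \<open>u\<close> is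
  unconstrained; such values enter \<open>A_grid\<close> with total coefficient zero.\<close>
definition upwind_scheme ::
  "real \<Rightarrow> real \<Rightarrow> real \<Rightarrow> (real \<times> real \<Rightarrow> real) \<Rightarrow> (real \<times> real \<Rightarrow> real) \<Rightarrow> (real \<times> real \<Rightarrow> real) \<Rightarrow>
   (real \<times> real \<Rightarrow> real \<Rightarrow> real) \<Rightarrow> (real \<Rightarrow> real \<times> real \<Rightarrow> real \<times> real \<Rightarrow> real) \<Rightarrow>
   (real \<times> real \<Rightarrow> real \<times> real \<Rightarrow> real) \<Rightarrow> (real \<Rightarrow> real \<times> real \<Rightarrow> real \<times> real \<Rightarrow> real) \<Rightarrow>
   real \<Rightarrow> nat \<Rightarrow> nat \<Rightarrow> nat \<Rightarrow> (nat \<Rightarrow> int \<Rightarrow> int \<Rightarrow> int \<Rightarrow> real) \<Rightarrow> bool" where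
  "upwind_scheme T L1 L2 c \<mu>a \<mu>s pt q I0 I1 dt M1 M2 M u \<longleftrightarrow>
     (let dx1 = L1 / real M1; dx2 = L2 / real M2; x = grid_point dx1 dx2; \<xi> = grid_dir M in
      (\<forall>k i j n. real k \<le> T / dt - 1 \<and> (x i j, \<xi> n) \<in> phase_space L1 L2 \<longrightarrow>
         1 / c (x i j) * ((u (Suc k) i j n - u k i j n) / dt) =
           A_grid dx1 dx2 M (u k) i j n
           - Sigma_grid dx1 dx2 \<mu>a \<mu>s (u (Suc k)) i j n
           + K_grid dx1 dx2 M \<mu>s pt (u k) i j n
           + q (real k * dt) (x i j) (\<xi> n)) \<and>
      (\<forall>i j n. (x i j, \<xi> n) \<in> phase_space L1 L2 \<longrightarrow> u 0 i j n = I0 (x i j) (\<xi> n)) \<and>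
      (\<forall>k i j n. real k \<le> T / dt \<and> (x i j, \<xi> n) \<in> inflow_boundary L1 L2 \<longrightarrow>
         u k i j n = I1 (real k * dt) (x i j) (\<xi> n)))"

text \<open>The supremum is taken in \<open>ennreal\<close>, so that it is \<open>0\<close> for a grid without points in
  \<open>X \<union> \<Gamma>\<^sub>-\<close> (which happens for \<open>M1 = M2 = 1\<close>).\<close>
definition grid_error ::
  "real \<Rightarrow> real \<Rightarrow> nat \<Rightarrow> nat \<Rightarrow> nat \<Rightarrow> (real \<times> real \<Rightarrow> real \<times> real \<Rightarrow> real) \<Rightarrow>
   (int \<Rightarrow> int \<Rightarrow> int \<Rightarrow> real) \<Rightarrow> ennreal" where
  "grid_error L1 L2 M1 M2 M f v =
     (let x = grid_point (L1 / real M1) (L2 / real M2); \<xi> = grid_dir M in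
      SUP (i, j, n) \<in> {(i, j, n). (x i j, \<xi> n) \<in> phase_space L1 L2 \<union> inflow_boundary L1 L2}.
        ennreal \<bar>f (x i j) (\<xi> n) - v i j n\<bar>)"

end

theory Submission
  imports Defs
begin

text \<open>
  Multiplying the error equation at an interior grid point by \<open>c \<Delta>t\<close> gives
  \<open>(1 + c \<Delta>t (\<mu>\<^sub>a + \<mu>\<^sub>s)) e' = (e + c \<Delta>t A e) + c \<Delta>t K e + \<rho>\<close>. Under the CFL condition \<open>e + c \<Delta>t A e\<close>
  is a convex combination of errors at points of \<open>X \<union> \<Gamma>\<^sub>-\<close>, and \<open>K\<close> is bounded, so the maximal error
  grows by at most a factor \<open>1 + \<kappa> \<Delta>t\<close> and an increment \<open>\<rho>\<close> per step. In \<open>\<rho>\<close> the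
  time discretisation contributes \<open>O(\<Delta>t\<^sup>2)\<close> even where \<open>1 / c\<close> is unbounded, because of the factor
  \<open>c \<Delta>t\<close>; the upwind differences contribute \<open>\<Delta>t O(\<Delta>x) = O(\<Delta>t\<^sup>2)\<close>; and the rectangle rule has
  the accuracy of the trapezoidal rule on periodic integrands, contributing \<open>\<Delta>t O(\<Delta>\<theta>\<^sup>2)\<close>.
  A discrete Gronwall argument sums this up.
\<close>

section \<open>Taylor estimates and quadrature\<close>

text \<open>The mean value inequality is applied twice along the segment: to \<open>f'\<close>,
  which gives the Lipschitz bound, and then to \<open>f\<close> minus its linear part at
  \<open>z\<close>. Derivatives are taken within \<open>S\<close> and only the segment has to lie in
  \<open>S\<close>, so endpoints on the boundary are allowed and \<open>S\<close> may fail to be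
  convex.\<close>

lemma C2_taylor_segment:
  fixes f :: "'a::real_normed_vector \<Rightarrow> real" and f' :: "'a \<Rightarrow> 'a \<Rightarrow>\<^sub>L real"
  assumes seg: "closed_segment z w \<subseteq> S"
    and f': "\<And>y. y \<in> S \<Longrightarrow> (f has_derivative blinfun_apply (f' y)) (at y within S)"
    and f'': "\<And>y. y \<in> S \<Longrightarrow> (f' has_derivative blinfun_apply (f'' y)) (at y within S)"
    and B: "\<And>y. y \<in> S \<Longrightarrow> norm (f'' y) \<le> B"
  shows "norm (f' w - f' z) \<le> B * norm (w - z)"
    and "\<bar>f w - f z - f' z (w - z)\<bar> \<le> B * (norm (w - z))\<^sup>2"
proof -
  let ?L = "closed_segment z w"
  have lip: "norm (f' y - f' z) \<le> B * norm (y - z)" if "y \<in> ?L" for y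
  proof (rule differentiable_bound[of ?L f' "\<lambda>y. blinfun_apply (f'' y)"])
    show "(f' has_derivative blinfun_apply (f'' x)) (at x within ?L)" if "x \<in> ?L" for x
      using f'' seg that by (meson has_derivative_subset subsetD)
    show "onorm (blinfun_apply (f'' x)) \<le> B" if "x \<in> ?L" for x
      using B seg that by (metis norm_blinfun.rep_eq subsetD)
  qed (use that in auto)
  then show "norm (f' w - f' z) \<le> B * norm (w - z)"
    by simp
  have "B \<ge> 0"
    using B[of z] seg by (meson ends_in_segment(1) norm_ge_zero order_trans subsetD)
  have "norm (f w - f z - f' z (w - z)) \<le> norm (w - z) * (B * norm (w - z))"
  proof (rule differentiable_bound_linearization[where S = ?L])
    show "z + t *\<^sub>R (w - z) \<in> ?L" if "t \<in> {0..1}" for t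
      using that by (auto simp: in_segment algebra_simps intro!: exI[of _ t])
    show "(f has_derivative blinfun_apply (f' x)) (at x within ?L)" if "x \<in> ?L" for x
      using f' seg that by (meson has_derivative_subset subsetD)
    show "onorm (blinfun_apply (f' x) - blinfun_apply (f' z)) \<le> B * norm (w - z)" if "x \<in> ?L" for x
    proof -
      have "onorm (blinfun_apply (f' x) - blinfun_apply (f' z)) = norm (f' x - f' z)"
        by (simp add: norm_blinfun.rep_eq minus_blinfun.rep_eq fun_diff_def)
      also have "\<dots> \<le> B * norm (x - z)"
        using lip that by blast
      also have "\<dots> \<le> B * norm (w - z)"
        using segment_bound(1)[OF that] \<open>B \<ge> 0\<close> by (intro mult_left_mono) auto
      finally show ?thesis .
    qed
  qed auto
  then show "\<bar>f w - f z - f' z (w - z)\<bar> \<le> B * (norm (w - z))\<^sup>2"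
    by (simp add: power2_eq_square mult_ac)
qed

section \<open>Trapezoidal and rectangle rules under a Lipschitz condition on the derivative\<close>

lemma taylor_lipschitz_deriv:
  fixes f f' :: "real \<Rightarrow> real"
  assumes f': "\<And>x. (f has_real_derivative f' x) (at x)"
    and lip: "\<And>x y. \<bar>f' x - f' y\<bar> \<le> B * \<bar>x - y\<bar>"
    and "x \<le> y"
  shows "\<bar>f y - f x - (y - x) * f' x\<bar> \<le> B * (y - x)\<^sup>2"
proof (cases "x = y")
  case False
  then obtain z where z: "x < z" "z < y" "f y - f x = (y - x) * f' z"
    using MVT2[of x y f f'] f' \<open>x \<le> y\<close> by auto
  have "B \<ge> 0"
    using lip[of 1 0] by simp
  have "\<bar>f y - f x - (y - x) * f' x\<bar> = (y - x) * \<bar>f' z - f' x\<bar>"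
    using z by (simp add: abs_mult flip: right_diff_distrib)
  also have "\<dots> \<le> (y - x) * (B * (y - x))"
    using z \<open>B \<ge> 0\<close> by (intro mult_left_mono order_trans[OF lip]) auto
  finally show ?thesis
    by (simp add: power2_eq_square mult_ac)
qed simp

text \<open>Both the integral and the trapezoidal value are compared with the exact integral of the
  tangent at \<open>a\<close>. The two deviations are at most \<open>B * h ^ 3\<close> and
  \<open>B * h ^ 3 / 2\<close>, rounded up to a common factor 2.\<close>

lemma trapezoid_cell:
  fixes f f' :: "real \<Rightarrow> real"
  assumes f': "\<And>x. (f has_real_derivative f' x) (at x)"
    and lip: "\<And>x y. \<bar>f' x - f' y\<bar> \<le> B * \<bar>x - y\<bar>"
    and "h \<ge> 0"
  shows "\<bar>integral {a..a + h} f - h * (f a + f (a + h)) / 2\<bar> \<le> 2 * B * h ^ 3"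
proof -
  have "B \<ge> 0"
    using lip[of 1 0] by simp
  have cont: "continuous_on {a..a + h} f"
    using f' by (meson DERIV_isCont continuous_at_imp_continuous_on)
  have 1: "((\<lambda>\<theta>. f a + (\<theta> - a) * f' a) has_integral
      ((a + h) * f a + (a + h - a)\<^sup>2 / 2 * f' a) - (a * f a + (a - a)\<^sup>2 / 2 * f' a)) {a..a + h}"
    using \<open>h \<ge> 0\<close>
    by (intro fundamental_theorem_of_calculus)
      (auto intro!: derivative_eq_intros simp flip: has_real_derivative_iff_has_vector_derivative)
  have 2: "(f has_integral integral {a..a + h} f) {a..a + h}"
    using cont by (intro integrable_integral integrable_continuous_real)
  have "norm (integral {a..a + h} f - (((a + h) * f a + (a + h - a)\<^sup>2 / 2 * f' a) - (a * f a + (a - a)\<^sup>2 / 2 * f' a)))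
      \<le> (B * h\<^sup>2) * measure lborel {a..a + h}"
  proof (rule has_integral_bound_real[OF _ finite.emptyI has_integral_diff[OF 2 1]])
    show "norm (f x - (f a + (x - a) * f' a)) \<le> B * h\<^sup>2" if "x \<in> {a..a + h} - {}" for x
    proof -
      have "\<bar>f x - f a - (x - a) * f' a\<bar> \<le> B * (x - a)\<^sup>2"
        using taylor_lipschitz_deriv[OF f' lip] that by auto
      also have "\<dots> \<le> B * h\<^sup>2"
        using that \<open>B \<ge> 0\<close> by (intro mult_left_mono power_mono) auto
      finally show ?thesis
        by (simp add: algebra_simps)
    qed
  qed (use \<open>B \<ge> 0\<close> in auto)
  then have A: "\<bar>integral {a..a + h} f - h * f a - h\<^sup>2 / 2 * f' a\<bar> \<le> B * h ^ 3"
    using \<open>h \<ge> 0\<close> by (simp add: algebra_simps power2_eq_square power3_eq_cube)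
  \<comment> \<open>The trapezoidal value uses \<open>f (a + h)\<close> where the tangent predicts
    \<open>f a + h * f' a\<close>; this mismatch enters with weight \<open>h / 2\<close>.\<close>
  have "\<bar>f (a + h) - f a - h * f' a\<bar> \<le> B * h\<^sup>2"
    using taylor_lipschitz_deriv[OF f' lip, of a "a + h"] \<open>h \<ge> 0\<close> by simp
  then have "h / 2 * \<bar>f (a + h) - f a - h * f' a\<bar> \<le> h / 2 * (B * h\<^sup>2)"
    using \<open>h \<ge> 0\<close> by (intro mult_left_mono) auto
  moreover have "h / 2 * \<bar>f (a + h) - f a - h * f' a\<bar> = \<bar>h / 2 * (f (a + h) - f a - h * f' a)\<bar>"
    using \<open>h \<ge> 0\<close> by (simp add: abs_mult)
  ultimately have C: "\<bar>h / 2 * (f (a + h) - f a - h * f' a)\<bar> \<le> B * h ^ 3 / 2"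
    by (simp add: power2_eq_square power3_eq_cube mult_ac)
  have "integral {a..a + h} f - h * (f a + f (a + h)) / 2
      = (integral {a..a + h} f - h * f a - h\<^sup>2 / 2 * f' a) - h / 2 * (f (a + h) - f a - h * f' a)"
    by (simp add: field_simps power2_eq_square)
  moreover have "B * h ^ 3 \<ge> 0"
    using \<open>B \<ge> 0\<close> \<open>h \<ge> 0\<close> by simp
  ultimately show ?thesis
    using A C by linarith
qed

text \<open>This is the composite trapezoidal rule, written as a left rectangle sum plus the end
  correction \<open>h * (f (real m * h) - f 0) / 2\<close>. In this form it follows by adding one
  cell at a time, and the correction vanishes when the end values agree.\<close>

lemma rectangle_rule:
  fixes f f' :: "real \<Rightarrow> real"
  assumes f': "\<And>x. (f has_real_derivative f' x) (at x)"
    and lip: "\<And>x y. \<bar>f' x - f' y\<bar> \<le> B * \<bar>x - y\<bar>"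
    and "h \<ge> 0"
  shows "\<bar>integral {0..real m * h} f - h * (\<Sum>\<nu><m. f (real \<nu> * h)) - h * (f (real m * h) - f 0) / 2\<bar>
    \<le> real m * (2 * B * h ^ 3)"
proof (induction m)
  case (Suc m)
  have cont: "continuous_on {0..real (Suc m) * h} f"
    using f' by (meson DERIV_isCont continuous_at_imp_continuous_on)
  have split: "integral {0..real (Suc m) * h} f
      = integral {0..real m * h} f + integral {real m * h..real m * h + h} f"
    using Henstock_Kurzweil_Integration.integral_combine[of 0 "real m * h" "real (Suc m) * h" f]
      integrable_continuous_real[OF cont] \<open>h \<ge> 0\<close> by (simp add: algebra_simps)
  show ?case
    using Suc.IH trapezoid_cell[OF f' lip \<open>h \<ge> 0\<close>, of "real m * h"]
    unfolding split by (simp add: field_simps abs_le_iff)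
qed simp

text \<open>Equal end values remove the correction term, so the rectangle sum coincides with the
  trapezoidal one; \<open>m\<close> cells of error of order \<open>h ^ 3\<close> with
  \<open>m * h = P\<close> leave order \<open>h ^ 2\<close>.\<close>

lemma periodic_rectangle_rule:
  fixes f f' :: "real \<Rightarrow> real"
  assumes f': "\<And>x. (f has_real_derivative f' x) (at x)"
    and lip: "\<And>x y. \<bar>f' x - f' y\<bar> \<le> B * \<bar>x - y\<bar>"
    and per: "f P = f 0" and "P > 0" "m > 0"
  shows "\<bar>integral {0..P} f - P / real m * (\<Sum>\<nu><m. f (real \<nu> * (P / real m)))\<bar>
    \<le> 2 * P * B * (P / real m)\<^sup>2"
proof -
  have 1: "real m * (2 * B * (P / real m) ^ 3) = 2 * P * B * (P / real m)\<^sup>2"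
    using \<open>m > 0\<close> by (simp add: field_simps power2_eq_square power3_eq_cube)
  have 2: "real m * (P / real m) = P"
    using \<open>m > 0\<close> by simp
  show ?thesis
    using rectangle_rule[OF f' lip, of "P / real m" m] \<open>P > 0\<close> per unfolding 1 2 by simp
qed

section \<open>Periodic functions and uniform bounds on the scattering kernel\<close>

lemma periodic_int:
  fixes f :: "real \<Rightarrow> 'a"
  assumes "\<And>x. f (x + p) = f x"
  shows "f (x + of_int k * p) = f x"
proof -
  have nat: "f (x + real n * p) = f x" for n x
  proof (induction n)
    case (Suc n)
    show ?case
      using assms[of "x + real n * p"] Suc.IH by (simp add: algebra_simps)
  qed simp
  show ?thesis
  proof (cases "k \<ge> 0")
    case True
    then show ?thesis
      using nat[of x "nat k"] by simp
  next
    case False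
    then show ?thesis
      using nat[of "x + of_int k * p" "nat (- k)"] by simp
  qed
qed

lemma periodic_representative:
  fixes f :: "real \<Rightarrow> 'a"
  assumes "\<And>x. f (x + p) = f x" "p > 0"
  obtains y where "y \<in> {0..p}" "f x = f y"
proof
  let ?k = "\<lfloor>x / p\<rfloor>"
  show "x + of_int (- ?k) * p \<in> {0..p}"
    using floor_divide_lower[OF \<open>p > 0\<close>, of x] floor_divide_upper[OF \<open>p > 0\<close>, of x]
    by (auto simp: algebra_simps)
  show "f x = f (x + of_int (- ?k) * p)"
    using periodic_int[of f p, OF assms(1)] by metis
qed

text \<open>\<open>deriv\<close> picks a number from the set of admissible derivatives, and
  translation by a period leaves this set unchanged, whether or not it is empty.\<close>

lemma deriv_periodic:
  fixes f :: "real \<Rightarrow> real"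
  assumes "\<And>x. f (x + p) = f x"
  shows "deriv f (x + p) = deriv f x"
proof -
  have "(f has_real_derivative D) (at (x + p)) \<longleftrightarrow> (f has_real_derivative D) (at x)" for D
    using DERIV_shift[of f D x p] assms by simp
  then show ?thesis
    by (simp add: deriv_def)
qed

text \<open>Two angles with equal cosine agree up to sign and a multiple of \<open>2 * pi\<close>,
  and \<open>f\<close> sees neither.\<close>

lemma even_periodic_arccos_cos:
  fixes f :: "real \<Rightarrow> 'a"
  assumes per: "\<And>x. f (x + 2 * pi) = f x" and even: "\<And>x. f (- x) = f x"
  shows "f (arccos (cos x)) = f x"
proof -
  have "cos (arccos (cos x)) = cos x"
    by (simp add: cos_arccos)
  then obtain n where "n \<in> \<int>"
    and n: "arccos (cos x) = x + 2 * n * pi \<or> arccos (cos x) = - x + 2 * n * pi"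
    using cos_eq by metis
  then obtain k where k: "n = of_int k"
    by (auto elim: Ints_cases)
  have "f (y + of_int k * (2 * pi)) = f y" for y
    using periodic_int[of f "2 * pi"] per by blast
  then have "f (y + 2 * of_int k * pi) = f y" for y
    by (simp add: mult_ac)
  then show ?thesis
    using n even unfolding k by metis
qed

text \<open>Replaces the angle in \<open>[0, \<pi>]\<close>, which is not a smooth function of the
  directions, by the signed difference of angles. The integrand over the circle thereby inherits the
  smoothness of \<open>pt x\<close>.\<close>

lemma kernel_dir:
  assumes "scattering_kernel \<Omega> pt" "x \<in> \<Omega>"
  shows "kernel pt x (dir a) (dir b) = pt x (b - a)"
proof -
  have "dir a \<bullet> dir b = cos (b - a)"
    by (simp add: dir_def cos_diff mult_ac)
  then show ?thesis
    using assms even_periodic_arccos_cos[of "pt x" "b - a"]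
    by (simp add: kernel_def scattering_kernel_def)
qed

text \<open>Everything is recovered from the bound on the second derivative, uniformly in
  \<open>x\<close>: by periodicity the first derivative has a zero, so it is bounded over one
  period; the unit integral forces a value at most 1 somewhere, so the nonnegative function itself
  is bounded. \<open>P\<close> adds all these bounds to serve as a single constant.\<close>

lemma scattering_kernel_bounds:
  assumes "scattering_kernel \<Omega> pt"
  obtains P where "P > 0"
    and "\<And>x \<alpha>. x \<in> \<Omega> \<Longrightarrow> (pt x has_real_derivative deriv (pt x) \<alpha>) (at \<alpha>)"
    and "\<And>x \<alpha>. x \<in> \<Omega> \<Longrightarrow> \<bar>pt x \<alpha>\<bar> \<le> P"
    and "\<And>x \<alpha>. x \<in> \<Omega> \<Longrightarrow> \<bar>deriv (pt x) \<alpha>\<bar> \<le> P"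
    and "\<And>x \<alpha> \<beta>. x \<in> \<Omega> \<Longrightarrow> \<bar>deriv (pt x) \<alpha> - deriv (pt x) \<beta>\<bar> \<le> P * \<bar>\<alpha> - \<beta>\<bar>"
proof -
  obtain P2' where P2': "\<And>x \<alpha>. x \<in> \<Omega> \<Longrightarrow> \<alpha> \<in> {0..2 * pi} \<Longrightarrow> \<bar>deriv (deriv (pt x)) \<alpha>\<bar> \<le> P2'"
    using assms by (force simp: scattering_kernel_def bdd_above_def)
  \<comment> \<open>For empty \<Omega> the bound \<open>P2'\<close> could be negative; the absolute
    value guards against this.\<close>
  define P2 where "P2 = \<bar>P2'\<bar>"
  define P where "P = 1 + P2 * (2 * pi) * (2 * pi) + P2 * (2 * pi) + P2"
  have "P2 \<ge> 0"
    by (simp add: P2_def)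
  have per: "pt x (\<alpha> + 2 * pi) = pt x \<alpha>" if "x \<in> \<Omega>" for x \<alpha>
    using assms that by (simp add: scattering_kernel_def)
  have D1: "(pt x has_real_derivative deriv (pt x) \<alpha>) (at \<alpha>)" if "x \<in> \<Omega>" for x \<alpha>
    using assms that by (simp add: scattering_kernel_def C2_real_def DERIV_deriv_iff_real_differentiable)
  have D2: "(deriv (pt x) has_real_derivative deriv (deriv (pt x)) \<alpha>) (at \<alpha>)" if "x \<in> \<Omega>" for x \<alpha>
    using assms that by (simp add: scattering_kernel_def C2_real_def DERIV_deriv_iff_real_differentiable)
  have per1: "deriv (pt x) (\<alpha> + 2 * pi) = deriv (pt x) \<alpha>" if "x \<in> \<Omega>" for x \<alpha>
    using deriv_periodic[of "pt x" "2 * pi"] per[OF that] by blast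
  have per2: "deriv (deriv (pt x)) (\<alpha> + 2 * pi) = deriv (deriv (pt x)) \<alpha>" if "x \<in> \<Omega>" for x \<alpha>
    using deriv_periodic[of "deriv (pt x)" "2 * pi"] per1[OF that] by blast
  have B2: "\<bar>deriv (deriv (pt x)) \<alpha>\<bar> \<le> P2" if "x \<in> \<Omega>" for x \<alpha>
    using periodic_representative[of "deriv (deriv (pt x))" "2 * pi" \<alpha>, OF per2[OF that]] P2'[OF that]
    by (metis P2_def abs_ge_self order_trans mult_pos_pos pi_gt_zero zero_less_numeral)
  have lip: "\<bar>deriv (pt x) \<alpha> - deriv (pt x) \<beta>\<bar> \<le> P2 * \<bar>\<alpha> - \<beta>\<bar>" if "x \<in> \<Omega>" for x \<alpha> \<beta>
    using field_differentiable_bound[of UNIV "deriv (pt x)" "deriv (deriv (pt x))" P2 \<alpha> \<beta>]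
      D2[OF that] B2[OF that] by auto
  have B1: "\<bar>deriv (pt x) \<alpha>\<bar> \<le> P2 * (2 * pi)" if x: "x \<in> \<Omega>" for x \<alpha>
  proof -
    \<comment> \<open>Rolle's theorem: the values at both ends of a period agree.\<close>
    obtain z where z: "0 < z" "z < 2 * pi" "deriv (pt x) z = 0"
      using MVT2[of 0 "2 * pi" "pt x" "deriv (pt x)"] D1[OF x] per[OF x, of 0] by auto
    obtain y where y: "y \<in> {0..2 * pi}" "deriv (pt x) \<alpha> = deriv (pt x) y"
      using periodic_representative[of "deriv (pt x)" "2 * pi" \<alpha>, OF per1[OF x]] by auto
    have "\<bar>deriv (pt x) \<alpha>\<bar> \<le> P2 * \<bar>y - z\<bar>"
      using lip[OF x, of y z] y z by simp
    also have "\<dots> \<le> P2 * (2 * pi)"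
      using y z \<open>P2 \<ge> 0\<close> by (intro mult_left_mono) auto
    finally show ?thesis .
  qed
  have B0: "\<bar>pt x \<alpha>\<bar> \<le> 1 + P2 * (2 * pi) * (2 * pi)" if x: "x \<in> \<Omega>" for x \<alpha>
  proof -
    have nn: "pt x \<beta> \<ge> 0" for \<beta>
      using assms x by (simp add: scattering_kernel_def)
    \<comment> \<open>Otherwise the integral over the period would be at least
      \<open>2 * pi\<close>, which exceeds 1.\<close>
    have "\<exists>z\<in>{0..2 * pi}. pt x z \<le> 1"
    proof (rule ccontr)
      assume "\<not> ?thesis"
      then have gt: "\<And>z. z \<in> {0..2 * pi} \<Longrightarrow> 1 \<le> pt x z"
        by force
      have "continuous_on {0..2 * pi} (pt x)"
        using D1[OF x] by (meson DERIV_isCont continuous_at_imp_continuous_on)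
      then have "integral {0..2 * pi} (\<lambda>_. 1 :: real) \<le> integral {0..2 * pi} (pt x)"
        using gt by (intro integral_le integrable_continuous_real) auto
      moreover have "integral {0..2 * pi} (pt x) = 1"
        using assms x by (simp add: scattering_kernel_def)
      ultimately show False
        using pi_gt3 by simp
    qed
    then obtain z where z: "z \<in> {0..2 * pi}" "pt x z \<le> 1"
      by blast
    obtain y where y: "y \<in> {0..2 * pi}" "pt x \<alpha> = pt x y"
      using periodic_representative[of "pt x" "2 * pi" \<alpha>, OF per[OF x]] by auto
    have "\<bar>pt x y - pt x z\<bar> \<le> P2 * (2 * pi) * \<bar>y - z\<bar>"
      using field_differentiable_bound[of UNIV "pt x" "deriv (pt x)" "P2 * (2 * pi)" y z]
        D1[OF x] B1[OF x] by auto
    also have "\<dots> \<le> P2 * (2 * pi) * (2 * pi)"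
      using y z \<open>P2 \<ge> 0\<close> by (intro mult_left_mono) auto
    finally show ?thesis
      using y z nn[of z] nn[of \<alpha>] by linarith
  qed
  have *: "1 + P2 * (2 * pi) * (2 * pi) \<le> P" "P2 * (2 * pi) \<le> P" "P2 \<le> P" "P > 0"
  proof -
    have "P2 * (2 * pi) * (2 * pi) \<ge> 0" "P2 * (2 * pi) \<ge> 0"
      using \<open>P2 \<ge> 0\<close> by auto
    then show "1 + P2 * (2 * pi) * (2 * pi) \<le> P" "P2 * (2 * pi) \<le> P" "P2 \<le> P" "P > 0"
      using \<open>P2 \<ge> 0\<close> unfolding P_def by linarith+
  qed
  show ?thesis
  proof (rule that[of P])
    show "\<bar>deriv (pt x) \<alpha> - deriv (pt x) \<beta>\<bar> \<le> P * \<bar>\<alpha> - \<beta>\<bar>" if "x \<in> \<Omega>" for x \<alpha> \<beta>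
      using lip[OF that, of \<alpha> \<beta>] *(3) by (meson abs_ge_zero mult_right_mono order_trans)
    show "\<bar>pt x \<alpha>\<bar> \<le> P" if "x \<in> \<Omega>" for x \<alpha>
      using B0[OF that, of \<alpha>] * by linarith
    show "\<bar>deriv (pt x) \<alpha>\<bar> \<le> P" if "x \<in> \<Omega>" for x \<alpha>
      using B1[OF that, of \<alpha>] * by linarith
  qed (use D1 * in auto)
qed

section \<open>Quadrature of the scattering integral\<close>

lemma norm_dir [simp]: "norm (dir \<theta>) = 1"
  by (simp add: dir_def norm_Pair)

text \<open>The periodic rectangle rule is applied to the product of the shifted kernel and
  \<open>g\<close>. The constant depends neither on \<open>x\<close>, \<open>M\<close>,
  \<open>n\<close> nor on \<open>g\<close>, which enters only through \<open>B\<close>; the same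
  \<open>P\<close> is made to bound the kernel.\<close>

lemma scattering_quadrature:
  assumes "scattering_kernel \<Omega> pt"
  obtains P where "P > 0"
    and "\<And>x a b. x \<in> \<Omega> \<Longrightarrow> \<bar>kernel pt x (dir a) (dir b)\<bar> \<le> P"
    and "\<And>x g g' B M n.
      \<lbrakk>x \<in> \<Omega>; M > 0; \<And>\<theta>. ((\<lambda>\<theta>. g (dir \<theta>)) has_real_derivative g' \<theta>) (at \<theta>);
       \<And>\<theta>. \<bar>g (dir \<theta>)\<bar> \<le> B; \<And>\<theta>. \<bar>g' \<theta>\<bar> \<le> B; \<And>\<theta> \<phi>. \<bar>g' \<theta> - g' \<phi>\<bar> \<le> B * \<bar>\<theta> - \<phi>\<bar>\<rbrakk> \<Longrightarrow>
       \<bar>circle_integral (\<lambda>\<xi>'. kernel pt x (grid_dir M n) \<xi>' * g \<xi>')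
         - 2 * pi / real M * (\<Sum>\<nu>\<in>{0..<int M}. kernel pt x (grid_dir M n) (grid_dir M \<nu>) * g (grid_dir M \<nu>))\<bar>
       \<le> P * B * (2 * pi / real M)\<^sup>2"
proof -
  obtain P where "P > 0"
    and der: "\<And>x \<alpha>. x \<in> \<Omega> \<Longrightarrow> (pt x has_real_derivative deriv (pt x) \<alpha>) (at \<alpha>)"
    and P0: "\<And>x \<alpha>. x \<in> \<Omega> \<Longrightarrow> \<bar>pt x \<alpha>\<bar> \<le> P"
    and P1: "\<And>x \<alpha>. x \<in> \<Omega> \<Longrightarrow> \<bar>deriv (pt x) \<alpha>\<bar> \<le> P"
    and P2: "\<And>x \<alpha> \<beta>. x \<in> \<Omega> \<Longrightarrow> \<bar>deriv (pt x) \<alpha> - deriv (pt x) \<beta>\<bar> \<le> P * \<bar>\<alpha> - \<beta>\<bar>"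
    using scattering_kernel_bounds[OF assms] by blast
  show ?thesis
  \<comment> \<open>The product below has a derivative with Lipschitz constant
    \<open>4 * P * B\<close>; over the period \<open>2 * pi\<close> the rectangle rule turns this
    into \<open>2 * (2 * pi) * (4 * P * B) = 16 * pi * P * B\<close>.\<close>
  proof (rule that[of "16 * pi * P"])
    have "P \<le> 16 * pi * P"
      using \<open>P > 0\<close> pi_gt3 by simp
    then show "\<bar>kernel pt x (dir a) (dir b)\<bar> \<le> 16 * pi * P" if "x \<in> \<Omega>" for x a b
      unfolding kernel_dir[OF assms that] using P0[OF that] by (meson order_trans)
  next
    fix x g g' B M n
    assume x: "x \<in> \<Omega>" and "(M::nat) > 0"
      and g': "\<And>\<theta>. ((\<lambda>\<theta>. g (dir \<theta>)) has_real_derivative g' \<theta>) (at \<theta>)"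
      and B0: "\<And>\<theta>. \<bar>g (dir \<theta>)\<bar> \<le> B" and B1: "\<And>\<theta>. \<bar>g' \<theta>\<bar> \<le> B"
      and B2: "\<And>\<theta> \<phi>. \<bar>g' \<theta> - g' \<phi>\<bar> \<le> B * \<bar>\<theta> - \<phi>\<bar>"
    define h where "h = 2 * pi / real M"
    define a where "a = of_int n * h"
    define f where "f \<theta> = pt x (\<theta> - a) * g (dir \<theta>)" for \<theta>
    define f' where "f' \<theta> = deriv (pt x) (\<theta> - a) * g (dir \<theta>) + pt x (\<theta> - a) * g' \<theta>" for \<theta>
    have "B \<ge> 0"
      using B0[of 0] by linarith
    have f': "(f has_real_derivative f' \<theta>) (at \<theta>)" for \<theta>
    proof -
      have "((\<lambda>\<theta>. pt x (\<theta> - a)) has_real_derivative deriv (pt x) (\<theta> - a) * 1) (at \<theta>)"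
        by (rule DERIV_chain2[OF der[OF x]]) (auto intro!: derivative_eq_intros)
      then show ?thesis
        unfolding f_def f'_def by (auto intro!: derivative_eq_intros g')
    qed
    have lip_g: "\<bar>g (dir \<theta>) - g (dir \<phi>)\<bar> \<le> B * \<bar>\<theta> - \<phi>\<bar>" for \<theta> \<phi>
      using field_differentiable_bound[of UNIV "\<lambda>\<theta>. g (dir \<theta>)" g' B \<theta> \<phi>] g' B1 by auto
    have lip_p: "\<bar>pt x (\<theta> - a) - pt x (\<phi> - a)\<bar> \<le> P * \<bar>\<theta> - \<phi>\<bar>" for \<theta> \<phi>
      using field_differentiable_bound[of UNIV "pt x" "deriv (pt x)" P "\<theta> - a" "\<phi> - a"]
        der[OF x] P1[OF x] by auto
    have lip: "\<bar>f' \<theta> - f' \<phi>\<bar> \<le> (4 * P * B) * \<bar>\<theta> - \<phi>\<bar>" for \<theta> \<phi>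
    proof -
      let ?d = "\<bar>\<theta> - \<phi>\<bar>"
      \<comment> \<open>Each of the two products of the product rule is telescoped, so that every
        summand contains just one difference and contributes \<open>P * B\<close> to the Lipschitz
        constant.\<close>
      have "f' \<theta> - f' \<phi> =
          (deriv (pt x) (\<theta> - a) - deriv (pt x) (\<phi> - a)) * g (dir \<theta>)
          + deriv (pt x) (\<phi> - a) * (g (dir \<theta>) - g (dir \<phi>))
          + (pt x (\<theta> - a) - pt x (\<phi> - a)) * g' \<theta> + pt x (\<phi> - a) * (g' \<theta> - g' \<phi>)"
        by (simp add: f'_def algebra_simps)
      moreover have "\<bar>(deriv (pt x) (\<theta> - a) - deriv (pt x) (\<phi> - a)) * g (dir \<theta>)\<bar> \<le> P * ?d * B"
        unfolding abs_mult using P2[OF x, of "\<theta> - a" "\<phi> - a"] B0[of \<theta>] \<open>P > 0\<close>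
        by (intro mult_mono) auto
      moreover have "\<bar>deriv (pt x) (\<phi> - a) * (g (dir \<theta>) - g (dir \<phi>))\<bar> \<le> P * (B * ?d)"
        unfolding abs_mult using P1[OF x] lip_g \<open>P > 0\<close> by (intro mult_mono) auto
      moreover have "\<bar>(pt x (\<theta> - a) - pt x (\<phi> - a)) * g' \<theta>\<bar> \<le> P * ?d * B"
        unfolding abs_mult using lip_p B1 \<open>P > 0\<close> by (intro mult_mono) auto
      moreover have "\<bar>pt x (\<phi> - a) * (g' \<theta> - g' \<phi>)\<bar> \<le> P * (B * ?d)"
        unfolding abs_mult using P0[OF x] B2 \<open>P > 0\<close> by (intro mult_mono) auto
      ultimately have "\<bar>f' \<theta> - f' \<phi>\<bar> \<le> P * ?d * B + P * (B * ?d) + P * ?d * B + P * (B * ?d)"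
        by linarith
      then show ?thesis
        by (simp add: mult_ac)
    qed
    have per: "f (2 * pi) = f 0"
    proof -
      have "pt x (- a + 2 * pi) = pt x (- a)"
        using assms x unfolding scattering_kernel_def by blast
      then show ?thesis
        by (simp add: f_def dir_def)
    qed
    have int: "circle_integral (\<lambda>\<xi>'. kernel pt x (grid_dir M n) \<xi>' * g \<xi>') = integral {0..2 * pi} f"
      by (simp add: circle_integral_def grid_dir_def kernel_dir[OF assms x] f_def[abs_def] a_def h_def)
    have "(\<Sum>\<nu>\<in>{0..<int M}. kernel pt x (grid_dir M n) (grid_dir M \<nu>) * g (grid_dir M \<nu>))
        = (\<Sum>\<nu>\<in>int ` {..<M}. f (of_int \<nu> * h))"
      by (rule sum.cong)
        (auto simp: grid_dir_def kernel_dir[OF assms x] f_def a_def h_def lessThan_atLeast0 image_int_atLeastLessThan)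
    also have "\<dots> = (\<Sum>\<nu><M. f (real \<nu> * h))"
      by (subst sum.reindex) auto
    finally have sum: "(\<Sum>\<nu>\<in>{0..<int M}. kernel pt x (grid_dir M n) (grid_dir M \<nu>) * g (grid_dir M \<nu>))
        = (\<Sum>\<nu><M. f (real \<nu> * h))" .
    have "\<bar>integral {0..2 * pi} f - h * (\<Sum>\<nu><M. f (real \<nu> * h))\<bar> \<le> 2 * (2 * pi) * (4 * P * B) * h\<^sup>2"
      using periodic_rectangle_rule[OF f' lip per _ \<open>M > 0\<close>] by (simp add: h_def)
    then show "\<bar>circle_integral (\<lambda>\<xi>'. kernel pt x (grid_dir M n) \<xi>' * g \<xi>')
         - 2 * pi / real M * (\<Sum>\<nu>\<in>{0..<int M}. kernel pt x (grid_dir M n) (grid_dir M \<nu>) * g (grid_dir M \<nu>))\<bar>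
       \<le> 16 * pi * P * B * (2 * pi / real M)\<^sup>2"
      unfolding int sum by (simp add: h_def mult_ac)
  qed (use \<open>P > 0\<close> in simp)
qed

section \<open>Consistency and stability of the scheme\<close>

lemma frontier_rect:
  assumes "L1 > 0" "L2 > 0"
  shows "frontier (rect L1 L2) = {0..L1} \<times> {0..L2} - {0<..<L1} \<times> {0<..<L2}"
  using assms by (simp add: rect_def frontier_def closure_Times interior_open open_Times)

text \<open>Upwind neighbours of interior grid points, together with the segments joining them, stay
  where the solution is smooth; an outflow boundary point is never upwind.\<close>
lemma upwind_segment:
  assumes "L1 > 0" "L2 > 0" and X: "((x1, x2), \<xi>) \<in> phase_space L1 L2"
  shows "\<lbrakk>fst \<xi> > 0; 0 \<le> y; y < L1\<rbrakk> \<Longrightarrow> ((y, x2), \<xi>) \<in> phase_space L1 L2 \<union> inflow_boundary L1 L2"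
    and "\<lbrakk>fst \<xi> < 0; 0 < y; y \<le> L1\<rbrakk> \<Longrightarrow> ((y, x2), \<xi>) \<in> phase_space L1 L2 \<union> inflow_boundary L1 L2"
    and "\<lbrakk>snd \<xi> > 0; 0 \<le> y; y < L2\<rbrakk> \<Longrightarrow> ((x1, y), \<xi>) \<in> phase_space L1 L2 \<union> inflow_boundary L1 L2"
    and "\<lbrakk>snd \<xi> < 0; 0 < y; y \<le> L2\<rbrakk> \<Longrightarrow> ((x1, y), \<xi>) \<in> phase_space L1 L2 \<union> inflow_boundary L1 L2"
proof -
  have "0 < x1" "x1 < L1" "0 < x2" "x2 < L2" "\<xi> \<in> sphere 0 1"
    using X by (auto simp: phase_space_def rect_def)
  note facts = this assms(1,2)
  note defs = phase_space_def inflow_boundary_def frontier_rect[OF assms(1,2), unfolded rect_def] corners_def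
    outward_normal_def rect_def inner_prod_def
  \<comment> \<open>On the side \<open>y = 0\<close> the outward normal is \<open>(-1, 0)\<close>,
    so a positive first component of \<xi> means inflow; \<open>0 < x2 < L2\<close> keeps the point
    away from the corners. The other three sides are analogous.\<close>
  show "\<lbrakk>fst \<xi> > 0; 0 \<le> y; y < L1\<rbrakk> \<Longrightarrow> ((y, x2), \<xi>) \<in> phase_space L1 L2 \<union> inflow_boundary L1 L2"
    using facts by (cases "y = 0") (auto simp: defs)
  show "\<lbrakk>fst \<xi> < 0; 0 < y; y \<le> L1\<rbrakk> \<Longrightarrow> ((y, x2), \<xi>) \<in> phase_space L1 L2 \<union> inflow_boundary L1 L2"
    using facts by (cases "y = L1") (auto simp: defs)
  show "\<lbrakk>snd \<xi> > 0; 0 \<le> y; y < L2\<rbrakk> \<Longrightarrow> ((x1, y), \<xi>) \<in> phase_space L1 L2 \<union> inflow_boundary L1 L2"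
    using facts by (cases "y = 0") (auto simp: defs)
  show "\<lbrakk>snd \<xi> < 0; 0 < y; y \<le> L2\<rbrakk> \<Longrightarrow> ((x1, y), \<xi>) \<in> phase_space L1 L2 \<union> inflow_boundary L1 L2"
    using facts by (cases "y = L2") (auto simp: defs)
qed

text \<open>The central difference together with the viscosity term collapses to a one-sided
  difference: the neighbour on the downwind side cancels. Hence a Taylor estimate is required only
  for the neighbour selected by the sign of \<open>a\<close>.\<close>

lemma upwind_difference_consistent:
  fixes a d :: real
  assumes "d > 0"
    and "a > 0 \<Longrightarrow> \<bar>vm - v + d * D\<bar> \<le> B * d\<^sup>2" "a < 0 \<Longrightarrow> \<bar>vp - v - d * D\<bar> \<le> B * d\<^sup>2"
  shows "\<bar>- a * ((vp - vm) / (2 * d)) + \<bar>a\<bar> * ((vp - 2 * v + vm) / (2 * d)) + a * D\<bar> \<le> \<bar>a\<bar> * B * d"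
proof -
  consider "a > 0" | "a = 0" | "a < 0"
    by linarith
  then show ?thesis
  proof cases
    case 1
    have "- a * ((vp - vm) / (2 * d)) + \<bar>a\<bar> * ((vp - 2 * v + vm) / (2 * d)) + a * D
        = a / d * (vm - v + d * D)"
      using 1 \<open>d > 0\<close> by (simp add: field_simps)
    moreover have "\<bar>a / d * (vm - v + d * D)\<bar> \<le> a / d * (B * d\<^sup>2)"
      unfolding abs_mult using assms(2) 1 \<open>d > 0\<close> by (intro mult_mono) auto
    moreover have "a / d * (B * d\<^sup>2) = \<bar>a\<bar> * B * d"
      using 1 \<open>d > 0\<close> by (simp add: power2_eq_square)
    ultimately show ?thesis
      by simp
  next
    case 3
    have "- a * ((vp - vm) / (2 * d)) + \<bar>a\<bar> * ((vp - 2 * v + vm) / (2 * d)) + a * D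
        = \<bar>a\<bar> / d * (vp - v - d * D)"
      using 3 \<open>d > 0\<close> by (simp add: field_simps)
    moreover have "\<bar>\<bar>a\<bar> / d * (vp - v - d * D)\<bar> \<le> \<bar>a\<bar> / d * (B * d\<^sup>2)"
      unfolding abs_mult using assms(3)[OF 3] \<open>d > 0\<close> by (intro mult_mono) auto
    moreover have "\<bar>a\<bar> / d * (B * d\<^sup>2) = \<bar>a\<bar> * B * d"
      using 3 \<open>d > 0\<close> by (simp add: power2_eq_square)
    ultimately show ?thesis
      by simp
  qed simp
qed

text \<open>Adding \<open>l * \<bar>a\<bar> / d * v\<close> cancels the diagonal part of the
  one-sided difference; what remains is the upwind neighbour with a nonnegative weight.\<close>

lemma upwind_difference_stable:
  fixes a d :: real
  assumes "d > 0" "l \<ge> 0" and "a > 0 \<Longrightarrow> \<bar>vm\<bar> \<le> E" "a < 0 \<Longrightarrow> \<bar>vp\<bar> \<le> E"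
  shows "\<bar>l * (- a * ((vp - vm) / (2 * d)) + \<bar>a\<bar> * ((vp - 2 * v + vm) / (2 * d))) + l * \<bar>a\<bar> / d * v\<bar>
    \<le> l * \<bar>a\<bar> / d * E"
proof -
  consider "a > 0" | "a = 0" | "a < 0"
    by linarith
  then show ?thesis
  proof cases
    case 1
    have "l * (- a * ((vp - vm) / (2 * d)) + \<bar>a\<bar> * ((vp - 2 * v + vm) / (2 * d))) + l * \<bar>a\<bar> / d * v
        = l * \<bar>a\<bar> / d * vm"
      using 1 \<open>d > 0\<close> by (simp add: field_simps)
    moreover have "\<bar>l * \<bar>a\<bar> / d * vm\<bar> \<le> l * \<bar>a\<bar> / d * E"
      unfolding abs_mult[of _ vm] using assms(1,2) assms(3)[OF 1] by (intro mult_mono) (auto simp: abs_mult)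
    ultimately show ?thesis
      by simp
  next
    case 3
    have "l * (- a * ((vp - vm) / (2 * d)) + \<bar>a\<bar> * ((vp - 2 * v + vm) / (2 * d))) + l * \<bar>a\<bar> / d * v
        = l * \<bar>a\<bar> / d * vp"
      using 3 \<open>d > 0\<close> by (simp add: field_simps)
    moreover have "\<bar>l * \<bar>a\<bar> / d * vp\<bar> \<le> l * \<bar>a\<bar> / d * E"
      unfolding abs_mult[of _ vp] using assms(1,2) assms(4)[OF 3] by (intro mult_mono) (auto simp: abs_mult)
    ultimately show ?thesis
      by simp
  qed simp
qed

section \<open>The two-dimensional advection and scattering operators\<close>

lemma A_grid_split:
  "A_grid dx1 dx2 M v i j n = (let \<xi> = grid_dir M n in
    (- fst \<xi> * ((v (i + 1) j n - v (i - 1) j n) / (2 * dx1))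
      + \<bar>fst \<xi>\<bar> * ((v (i + 1) j n - 2 * v i j n + v (i - 1) j n) / (2 * dx1)))
    + (- snd \<xi> * ((v i (j + 1) n - v i (j - 1) n) / (2 * dx2))
      + \<bar>snd \<xi>\<bar> * ((v i (j + 1) n - 2 * v i j n + v i (j - 1) n) / (2 * dx2))))"
  by (simp add: A_grid_def Let_def)

lemma A_grid_consistent:
  assumes "dx1 > 0" "dx2 > 0" "B \<ge> 0" and \<xi>: "grid_dir M n = \<xi>"
    and "fst \<xi> > 0 \<Longrightarrow> \<bar>v (i - 1) j n - v i j n + dx1 * G1\<bar> \<le> B * dx1\<^sup>2"
    and "fst \<xi> < 0 \<Longrightarrow> \<bar>v (i + 1) j n - v i j n - dx1 * G1\<bar> \<le> B * dx1\<^sup>2"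
    and "snd \<xi> > 0 \<Longrightarrow> \<bar>v i (j - 1) n - v i j n + dx2 * G2\<bar> \<le> B * dx2\<^sup>2"
    and "snd \<xi> < 0 \<Longrightarrow> \<bar>v i (j + 1) n - v i j n - dx2 * G2\<bar> \<le> B * dx2\<^sup>2"
  shows "\<bar>A_grid dx1 dx2 M v i j n + (fst \<xi> * G1 + snd \<xi> * G2)\<bar> \<le> B * (dx1 + dx2)"
proof -
  define A1 where "A1 = - fst \<xi> * ((v (i + 1) j n - v (i - 1) j n) / (2 * dx1))
      + \<bar>fst \<xi>\<bar> * ((v (i + 1) j n - 2 * v i j n + v (i - 1) j n) / (2 * dx1))"
  define A2 where "A2 = - snd \<xi> * ((v i (j + 1) n - v i (j - 1) n) / (2 * dx2))
      + \<bar>snd \<xi>\<bar> * ((v i (j + 1) n - 2 * v i j n + v i (j - 1) n) / (2 * dx2))"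
  have "\<bar>fst \<xi>\<bar> \<le> 1" "\<bar>snd \<xi>\<bar> \<le> 1"
    unfolding \<xi>[symmetric] by (auto simp: grid_dir_def dir_def)
  then have "\<bar>fst \<xi>\<bar> * (B * dx1) \<le> 1 * (B * dx1)" "\<bar>snd \<xi>\<bar> * (B * dx2) \<le> 1 * (B * dx2)"
    using assms(1-3) by (intro mult_right_mono; simp)+
  moreover have "\<bar>A1 + fst \<xi> * G1\<bar> \<le> \<bar>fst \<xi>\<bar> * B * dx1"
    using upwind_difference_consistent[OF assms(1,5,6)] unfolding A1_def .
  moreover have "\<bar>A2 + snd \<xi> * G2\<bar> \<le> \<bar>snd \<xi>\<bar> * B * dx2"
    using upwind_difference_consistent[OF assms(2,7,8)] unfolding A2_def .
  moreover have "A_grid dx1 dx2 M v i j n = A1 + A2"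
    unfolding A_grid_split Let_def \<xi> A1_def A2_def ..
  ultimately show ?thesis
    by (simp add: algebra_simps abs_le_iff)
qed

text \<open>The expression is a combination of the value at the point and its upwind neighbours with
  weights \<open>1 - s1 - s2\<close>, \<open>s1\<close> and \<open>s2\<close>. The weights sum to 1
  and the CFL condition makes the first one nonnegative, so the combination is convex. Unconstrained
  values at outflow points never enter.\<close>

lemma A_grid_stable:
  assumes "dx1 > 0" "dx2 > 0" "l \<ge> 0" "l / dx1 + l / dx2 \<le> 1" and \<xi>: "grid_dir M n = \<xi>"
    and "\<bar>v i j n\<bar> \<le> E"
    and "fst \<xi> > 0 \<Longrightarrow> \<bar>v (i - 1) j n\<bar> \<le> E" "fst \<xi> < 0 \<Longrightarrow> \<bar>v (i + 1) j n\<bar> \<le> E"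
    and "snd \<xi> > 0 \<Longrightarrow> \<bar>v i (j - 1) n\<bar> \<le> E" "snd \<xi> < 0 \<Longrightarrow> \<bar>v i (j + 1) n\<bar> \<le> E"
  shows "\<bar>v i j n + l * A_grid dx1 dx2 M v i j n\<bar> \<le> E"
proof -
  define s1 where "s1 = l * \<bar>fst \<xi>\<bar> / dx1"
  define s2 where "s2 = l * \<bar>snd \<xi>\<bar> / dx2"
  define A1 where "A1 = - fst \<xi> * ((v (i + 1) j n - v (i - 1) j n) / (2 * dx1))
      + \<bar>fst \<xi>\<bar> * ((v (i + 1) j n - 2 * v i j n + v (i - 1) j n) / (2 * dx1))"
  define A2 where "A2 = - snd \<xi> * ((v i (j + 1) n - v i (j - 1) n) / (2 * dx2))
      + \<bar>snd \<xi>\<bar> * ((v i (j + 1) n - 2 * v i j n + v i (j - 1) n) / (2 * dx2))"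
  have "\<bar>fst \<xi>\<bar> \<le> 1" "\<bar>snd \<xi>\<bar> \<le> 1"
    unfolding \<xi>[symmetric] by (auto simp: grid_dir_def dir_def)
  then have "s1 \<le> l / dx1" "s2 \<le> l / dx2"
    using assms(1-3) by (auto simp: s1_def s2_def intro!: divide_right_mono mult_left_le)
  then have "0 \<le> 1 - s1 - s2"
    using assms(4) by linarith
  then have "\<bar>(1 - s1 - s2) * v i j n\<bar> \<le> (1 - s1 - s2) * E"
    using assms(6) by (simp add: abs_mult mult_left_mono)
  moreover have "\<bar>l * A1 + s1 * v i j n\<bar> \<le> s1 * E"
    using upwind_difference_stable[OF assms(1,3,7,8)] unfolding A1_def s1_def .
  moreover have "\<bar>l * A2 + s2 * v i j n\<bar> \<le> s2 * E"
    using upwind_difference_stable[OF assms(2,3,9,10)] unfolding A2_def s2_def .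
  moreover have "v i j n + l * A_grid dx1 dx2 M v i j n
      = (1 - s1 - s2) * v i j n + (l * A1 + s1 * v i j n) + (l * A2 + s2 * v i j n)"
    unfolding A_grid_split Let_def \<xi> A1_def[symmetric] A2_def[symmetric] by (simp add: algebra_simps)
  moreover have "(1 - s1 - s2) * E = E - s1 * E - s2 * E"
    by (simp add: algebra_simps)
  ultimately show ?thesis
    by linarith
qed

lemma A_grid_diff:
  "A_grid dx1 dx2 M (\<lambda>i j n. v i j n - w i j n) i j n = A_grid dx1 dx2 M v i j n - A_grid dx1 dx2 M w i j n"
  unfolding A_grid_def Let_def by (simp add: diff_divide_distrib add_divide_distrib algebra_simps)

lemma K_grid_diff:
  "K_grid dx1 dx2 M \<mu>s pt (\<lambda>i j n. v i j n - w i j n) i j n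
    = K_grid dx1 dx2 M \<mu>s pt v i j n - K_grid dx1 dx2 M \<mu>s pt w i j n"
  unfolding K_grid_def Let_def by (simp add: sum_subtractf right_diff_distrib)

text \<open>There are \<open>M\<close> summands with weight \<open>2 * pi / real M\<close> each, so
  the bound does not depend on the angular mesh. It is crude, but it only affects the rate of
  exponential growth in the final estimate.\<close>

lemma K_grid_bound:
  assumes "M > 0" "0 \<le> \<mu>s (grid_point dx1 dx2 i j)" "\<mu>s (grid_point dx1 dx2 i j) \<le> S" "P \<ge> 0"
    and ker: "\<And>a b. \<bar>kernel pt (grid_point dx1 dx2 i j) (dir a) (dir b)\<bar> \<le> P"
    and E: "\<And>\<nu>. \<bar>v i j \<nu>\<bar> \<le> E"
  shows "\<bar>K_grid dx1 dx2 M \<mu>s pt v i j n\<bar> \<le> S * (2 * pi * P) * E"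
proof -
  have "E \<ge> 0"
    using E[of 0] by linarith
  have "\<bar>\<Sum>\<nu>\<in>{0..<int M}. kernel pt (grid_point dx1 dx2 i j) (grid_dir M n) (grid_dir M \<nu>) * v i j \<nu>\<bar>
      \<le> (\<Sum>\<nu>\<in>{0..<int M}. P * E)"
    by (rule order_trans[OF sum_abs], rule sum_mono)
      (use ker E \<open>P \<ge> 0\<close> in \<open>auto simp: abs_mult grid_dir_def intro!: mult_mono\<close>)
  then have "2 * pi / real M * \<bar>\<Sum>\<nu>\<in>{0..<int M}. kernel pt (grid_point dx1 dx2 i j) (grid_dir M n) (grid_dir M \<nu>) * v i j \<nu>\<bar>
      \<le> 2 * pi / real M * (real M * (P * E))"
    by (intro mult_left_mono) auto
  also have "\<dots> = 2 * pi * P * E"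
    using \<open>M > 0\<close> by simp
  finally have *: "2 * pi / real M * \<bar>\<Sum>\<nu>\<in>{0..<int M}. kernel pt (grid_point dx1 dx2 i j) (grid_dir M n) (grid_dir M \<nu>) * v i j \<nu>\<bar>
      \<le> 2 * pi * P * E" .
  have "\<bar>K_grid dx1 dx2 M \<mu>s pt v i j n\<bar> = \<mu>s (grid_point dx1 dx2 i j) *
      (2 * pi / real M * \<bar>\<Sum>\<nu>\<in>{0..<int M}. kernel pt (grid_point dx1 dx2 i j) (grid_dir M n) (grid_dir M \<nu>) * v i j \<nu>\<bar>)"
    using assms(2) by (simp add: K_grid_def Let_def abs_mult)
  also have "\<dots> \<le> S * (2 * pi * P * E)"
    by (rule mult_mono[OF assms(3) *]) (use assms(2,3) in auto)
  finally show ?thesis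
    by (simp add: mult_ac)
qed

text \<open>One time step at one interior grid point, in scalars: \<open>w\<close> is the exact and
  \<open>u\<close> the numerical value, primes mark the new time level, \<open>AI\<close> and
  \<open>KI\<close> are the discrete operators applied to the exact solution, and \<open>X\<close>
  and \<open>Q\<close> are the exact advection and scattering terms. The assumptions separate the
  consistency errors from the stability bounds.\<close>

lemma error_step:
  fixes c dt :: real
  assumes "dt > 0" "0 < c" "c \<le> cm" "0 \<le> \<sigma>" "\<sigma> \<le> S" "B \<ge> 0"
    and pde: "1 / c * It = - X - \<sigma> * w + Q + q"
    and scheme: "1 / c * ((u' - u) / dt) = A - \<sigma> * u' + K + q"
    and time: "\<bar>w' - w - dt * It\<bar> \<le> B * dt\<^sup>2" "\<bar>w' - w\<bar> \<le> B * dt"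
    and advection: "\<bar>AI + X\<bar> \<le> \<tau>1" and stable: "\<bar>(w - u) + c * dt * (AI - A)\<bar> \<le> E"
    and quadrature: "\<bar>Q - KI\<bar> \<le> \<tau>2" and scattering: "\<bar>KI - K\<bar> \<le> \<kappa> * E"
  shows "\<bar>w' - u'\<bar> \<le> (1 + cm * \<kappa> * dt) * E + dt * (B * dt + cm * (\<tau>1 + \<tau>2 + S * B * dt))"
proof -
  define l where "l = c * dt"
  have l: "0 \<le> l" "l \<le> cm * dt"
    using assms(1-3) by (auto simp: l_def)
  have 1: "dt * It = l * (- X - \<sigma> * w + Q + q)"
    using assms(1,2) unfolding pde[symmetric] by (simp add: l_def)
  have 2: "u' - u = l * (A - \<sigma> * u' + K + q)"
    using assms(1,2) unfolding scheme[symmetric] by (simp add: l_def)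
  \<comment> \<open>The last term of \<open>R\<close> appears because the scheme takes absorption at
    the new time level, while the differential equation is used at the old one.\<close>
  define R where "R = (KI - K) + (Q - KI) - (AI + X) + \<sigma> * (w' - w)"
  have eq: "(1 + l * \<sigma>) * (w' - u') = ((w - u) + l * (AI - A)) + (w' - w - dt * It) + l * R"
    unfolding 1 R_def using 2 by (simp add: algebra_simps)
  have "\<bar>\<sigma> * (w' - w)\<bar> \<le> S * (B * dt)"
    unfolding abs_mult using time(2) assms(4,5) by (intro mult_mono) auto
  then have "\<bar>R\<bar> \<le> \<kappa> * E + \<tau>2 + \<tau>1 + S * B * dt" (is "_ \<le> ?R")
    using advection quadrature scattering unfolding R_def by linarith
  then have "\<bar>l * R\<bar> \<le> cm * dt * ?R"
    unfolding abs_mult using l by (intro mult_mono) auto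
  then have "\<bar>(1 + l * \<sigma>) * (w' - u')\<bar> \<le> E + B * dt\<^sup>2 + cm * dt * ?R"
    unfolding eq using stable time(1) unfolding l_def[symmetric] by linarith
  moreover have "1 * \<bar>w' - u'\<bar> \<le> \<bar>1 + l * \<sigma>\<bar> * \<bar>w' - u'\<bar>"
    using l(1) \<open>0 \<le> \<sigma>\<close> by (intro mult_right_mono) auto
  ultimately have "\<bar>w' - u'\<bar> \<le> E + B * dt\<^sup>2 + cm * dt * ?R"
    by (simp add: abs_mult)
  also have "\<dots> = (1 + cm * \<kappa> * dt) * E + dt * (B * dt + cm * (\<tau>1 + \<tau>2 + S * B * dt))"
    by (simp add: algebra_simps power2_eq_square)
  finally show ?thesis .
qed

text \<open>Induction step showing that \<open>real k * h * \<tau> * (1 + \<kappa> * h) ^ k\<close>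
  majorises every sequence starting at 0 that grows by the factor \<open>1 + \<kappa> * h\<close>
  and the increment \<open>h * \<tau>\<close>: the increment is absorbed since the power is at least
  1.\<close>

lemma discrete_gronwall:
  fixes \<kappa> h :: real
  assumes "\<kappa> \<ge> 0" "h \<ge> 0" "\<tau> \<ge> 0"
  shows "(1 + \<kappa> * h) * (real k * h * \<tau> * (1 + \<kappa> * h) ^ k) + h * \<tau>
    \<le> real (Suc k) * h * \<tau> * (1 + \<kappa> * h) ^ Suc k"
proof -
  have "h * \<tau> * 1 \<le> h * \<tau> * (1 + \<kappa> * h) ^ Suc k"
    using assms by (intro mult_left_mono one_le_power) auto
  then show ?thesis
    by (simp add: algebra_simps)
qed

section \<open>Regularity of the solution\<close>

text \<open>Translates the abstract derivatives in the coordinates \<open>(t, x, \<theta>)\<close>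
  into the scalar Taylor estimates that the scheme needs. The derivatives occurring in the equation
  are identified with partial derivatives of the abstract one, so that the same \<open>It\<close>,
  \<open>G1\<close> and \<open>G2\<close> satisfy both the equation and the estimates.\<close>

lemma solution_regularity:
  assumes "T > 0"
    and P: "solves_P T L1 L2 c \<mu>a \<mu>s pt q I0 I1 I" and C2: "bounded_C2_solution T L1 L2 I"
  obtains B where "B > 0"
    and "\<And>t x1 x2 \<xi>. t \<in> {0..<T} \<Longrightarrow> ((x1, x2), \<xi>) \<in> phase_space L1 L2 \<Longrightarrow>
      \<exists>It G1 G2.
        1 / c (x1, x2) * It = - (fst \<xi> * G1 + snd \<xi> * G2)
          - (\<mu>a (x1, x2) + \<mu>s (x1, x2)) * I t (x1, x2) \<xi>
          + \<mu>s (x1, x2) * circle_integral (\<lambda>\<xi>'. kernel pt (x1, x2) \<xi> \<xi>' * I t (x1, x2) \<xi>')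
          + q t (x1, x2) \<xi> \<and>
        (\<forall>s\<in>{t..T}. \<bar>I s (x1, x2) \<xi> - I t (x1, x2) \<xi> - (s - t) * It\<bar> \<le> B * (s - t)\<^sup>2 \<and>
          \<bar>I s (x1, x2) \<xi> - I t (x1, x2) \<xi>\<bar> \<le> B * (s - t)) \<and>
        (\<forall>y. (\<forall>z\<in>closed_segment x1 y. ((z, x2), \<xi>) \<in> phase_space L1 L2 \<union> inflow_boundary L1 L2) \<longrightarrow>
          \<bar>I t (y, x2) \<xi> - I t (x1, x2) \<xi> - (y - x1) * G1\<bar> \<le> B * (y - x1)\<^sup>2) \<and>
        (\<forall>y. (\<forall>z\<in>closed_segment x2 y. ((x1, z), \<xi>) \<in> phase_space L1 L2 \<union> inflow_boundary L1 L2) \<longrightarrow>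
          \<bar>I t (x1, y) \<xi> - I t (x1, x2) \<xi> - (y - x2) * G2\<bar> \<le> B * (y - x2)\<^sup>2)"
    and "\<And>t x. t \<in> {0..<T} \<Longrightarrow> x \<in> rect L1 L2 \<Longrightarrow>
      \<exists>J. (\<forall>\<theta>. ((\<lambda>\<theta>. I t x (dir \<theta>)) has_real_derivative J \<theta>) (at \<theta>)) \<and>
        (\<forall>\<theta>. \<bar>I t x (dir \<theta>)\<bar> \<le> B) \<and> (\<forall>\<theta>. \<bar>J \<theta>\<bar> \<le> B) \<and> (\<forall>\<theta> \<phi>. \<bar>J \<theta> - J \<phi>\<bar> \<le> B * \<bar>\<theta> - \<phi>\<bar>)"
proof -
  let ?D = "phase_space L1 L2 \<union> inflow_boundary L1 L2"
  \<comment> \<open>The angle runs over all reals, so motion in the direction variable never meets a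
    cut of the circle.\<close>
  define S where "S = {(t, x, \<theta>). t \<in> {0..<T} \<and> (x, dir \<theta>) \<in> ?D}"
  define f where "f = (\<lambda>(t, x, \<theta>). I t x (dir \<theta>))"
  obtain f' and f'' where
        D1: "\<And>z. z \<in> S \<Longrightarrow> (f has_derivative blinfun_apply (f' z)) (at z within S)"
    and D2: "\<And>z. z \<in> S \<Longrightarrow> (f' has_derivative blinfun_apply (f'' z)) (at z within S)"
    and bdd: "bounded (f ` S)" "bounded (f' ` S)" "bounded (f'' ` S)"
    using C2 unfolding bounded_C2_solution_def bounded_C2_on_def S_def[symmetric] f_def[symmetric]
    by blast
  obtain b0 where b0: "\<And>z. z \<in> S \<Longrightarrow> norm (f z) \<le> b0"
    using bdd(1) by (auto simp: bounded_iff)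
  obtain b1 where b1: "\<And>z. z \<in> S \<Longrightarrow> norm (f' z) \<le> b1"
    using bdd(2) by (auto simp: bounded_iff)
  obtain b2 where b2: "\<And>z. z \<in> S \<Longrightarrow> norm (f'' z) \<le> b2"
    using bdd(3) by (auto simp: bounded_iff)
  define b where "b = 1 + \<bar>b0\<bar> + \<bar>b1\<bar> + \<bar>b2\<bar>"
  have B0: "\<bar>f z\<bar> \<le> b" and B1: "norm (f' z) \<le> b" and B2: "norm (f'' z) \<le> b" if "z \<in> S" for z
    using b0[OF that] b1[OF that] b2[OF that] by (auto simp: b_def)
  \<comment> \<open>The factor \<open>1 + T\<close> is for the Lipschitz bound in time, obtained
    from \<open>b * (s - t)\<close> and a Taylor remainder of at most
    \<open>b * T * (s - t)\<close>.\<close>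
  define B where "B = b * (1 + T)"
  have "b \<ge> 1"
    by (simp add: b_def)
  then have "b \<le> B"
    using \<open>T > 0\<close> by (simp add: B_def)
  have scale: "h * blinfun_apply L (1, 0, 0) = blinfun_apply L (h, 0, 0)"
      "h * blinfun_apply L (0, 0, 1) = blinfun_apply L (0, 0, h)"
    for h and L :: "(real \<times> (real \<times> real) \<times> real) \<Rightarrow>\<^sub>L real"
    using blinfun.scaleR_right[of L h "(1, 0, 0)"] blinfun.scaleR_right[of L h "(0, 0, 1)"] by simp_all
  note taylor = C2_taylor_segment[OF _ D1 D2 B2]
  show ?thesis
  proof (rule that[of B])
    show "B > 0"
      using \<open>b \<ge> 1\<close> \<open>b \<le> B\<close> by simp
  next
    fix t x1 x2 \<xi>
    assume t: "t \<in> {0..<T}" and X: "((x1, x2), \<xi>) \<in> phase_space L1 L2"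
    obtain \<theta> where \<theta>: "\<xi> = dir \<theta>"
    proof -
      have "(fst \<xi>)\<^sup>2 + (snd \<xi>)\<^sup>2 = 1"
        using X by (cases \<xi>) (auto simp: phase_space_def norm_Pair)
      then show ?thesis
        using that sincos_total_2pi by (metis dir_def prod.collapse)
    qed
    define x where "x = (x1, x2)"
    define z where "z = (t, x, \<theta>)"
    have "z \<in> S"
      using t X by (simp add: S_def z_def \<theta> x_def)
    have "x \<in> rect L1 L2"
      using X by (simp add: phase_space_def x_def)
    obtain It G where It: "((\<lambda>s. I s x \<xi>) has_real_derivative It) (at t within {0..<T})"
      and G: "GDERIV (\<lambda>y. I t y \<xi>) x :> G"
      and pde: "1 / c x * It = - (\<xi> \<bullet> G) - (\<mu>a x + \<mu>s x) * I t x \<xi>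
          + \<mu>s x * circle_integral (\<lambda>\<xi>'. kernel pt x \<xi> \<xi>' * I t x \<xi>') + q t x \<xi>"
      using P t X unfolding solves_P_def x_def by fastforce
    \<comment> \<open>Derivatives within \<open>{0..<T}\<close> are unique because no point of this
      interval is isolated; at \<open>t = 0\<close> both are one-sided.\<close>
    have It_eq: "f' z (1, 0, 0) = It"
    proof -
      have "(\<lambda>s. (s, x, \<theta>)) ` {0..<T} \<subseteq> S"
        using X by (auto simp: S_def \<theta> x_def)
      then have "(f has_derivative f' z) (at (t, x, \<theta>) within (\<lambda>s. (s, x, \<theta>)) ` {0..<T})"
        using D1[OF \<open>z \<in> S\<close>] unfolding z_def by (meson has_derivative_subset)
      then have "((\<lambda>s. f (s, x, \<theta>)) has_derivative (\<lambda>h. f' z (h, 0, 0))) (at t within {0..<T})"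
        by (rule has_derivative_in_compose[rotated]) (auto intro!: derivative_eq_intros simp: zero_prod_def)
      then have "((\<lambda>s. I s x \<xi>) has_vector_derivative f' z (1, 0, 0)) (at t within {0..<T})"
        by (simp add: has_vector_derivative_def f_def \<theta> scale)
      moreover have "((\<lambda>s. I s x \<xi>) has_vector_derivative It) (at t within {0..<T})"
        using It by (simp add: has_real_derivative_iff_has_vector_derivative)
      moreover have "at t within {0..<T} \<noteq> bot"
        using t connected_imp_perfect[of "{0..<T}" t] by (auto simp: trivial_limit_within)
      ultimately show ?thesis
        using vector_derivative_unique_within by blast
    qed
    \<comment> \<open>The rectangle is open, so the derivative within it is the full gradient at
      \<open>x\<close>.\<close>
    have G_eq: "f' z (0, h, 0) = h \<bullet> G" for h
    proof -
      have "open (rect L1 L2)"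
        by (simp add: rect_def open_Times)
      have "(\<lambda>y. (t, y, \<theta>)) ` rect L1 L2 \<subseteq> S"
        using t by (auto simp: S_def phase_space_def)
      then have "(f has_derivative f' z) (at (t, x, \<theta>) within (\<lambda>y. (t, y, \<theta>)) ` rect L1 L2)"
        using D1[OF \<open>z \<in> S\<close>] unfolding z_def by (meson has_derivative_subset)
      then have "((\<lambda>y. f (t, y, \<theta>)) has_derivative (\<lambda>h. f' z (0, h, 0))) (at x within rect L1 L2)"
        by (rule has_derivative_in_compose[rotated]) (auto intro!: derivative_eq_intros simp: zero_prod_def)
      then have "((\<lambda>y. I t y \<xi>) has_derivative (\<lambda>h. f' z (0, h, 0))) (at x)"
        using at_within_open[OF \<open>x \<in> rect L1 L2\<close> \<open>open (rect L1 L2)\<close>] by (simp add: f_def \<theta>)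
      then show ?thesis
        using has_derivative_unique G unfolding gderiv_def by metis
    qed
    have time: "\<bar>I s x \<xi> - I t x \<xi> - (s - t) * It\<bar> \<le> b * (s - t)\<^sup>2" if s: "s \<in> {t..<T}" for s
    proof -
      have "closed_segment z (s, x, \<theta>) \<subseteq> S"
        using t s X by (auto simp: S_def z_def \<theta> x_def closed_segment_eq_real_ivl dest!: closed_segment_PairD)
      from taylor(2)[OF this]
      have "\<bar>f (s, x, \<theta>) - f z - f' z (s - t, 0, 0)\<bar> \<le> b * (norm (s - t))\<^sup>2"
        by (simp add: z_def norm_Pair flip: zero_prod_def)
      then show ?thesis
        unfolding scale(1)[of "s - t", symmetric] It_eq by (simp add: f_def z_def \<theta>)
    qed
    \<comment> \<open>The last time step may end at \<open>T\<close>, which lies outside the domain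
      of smoothness; the estimate is carried there by the left limit that defines
      \<open>I T\<close>.\<close>
    have time': "\<bar>I s x \<xi> - I t x \<xi> - (s - t) * It\<bar> \<le> b * (s - t)\<^sup>2" if s: "s \<in> {t..T}" for s
    proof (cases "s = T")
      case True
      have lim: "((\<lambda>t. I t x \<xi>) \<longlongrightarrow> I T x \<xi>) (at_left T)"
        using P X unfolding solves_P_def x_def by blast
      show ?thesis
        unfolding True
      proof (rule tendsto_le[of "at_left T"])
        show "((\<lambda>s. \<bar>I s x \<xi> - I t x \<xi> - (s - t) * It\<bar>) \<longlongrightarrow> \<bar>I T x \<xi> - I t x \<xi> - (T - t) * It\<bar>) (at_left T)"
          by (intro tendsto_intros lim)
        show "((\<lambda>s. b * (s - t)\<^sup>2) \<longlongrightarrow> b * (T - t)\<^sup>2) (at_left T)"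
          by (intro tendsto_intros)
        show "\<forall>\<^sub>F s in at_left T. \<bar>I s x \<xi> - I t x \<xi> - (s - t) * It\<bar> \<le> b * (s - t)\<^sup>2"
          using t by (intro eventually_at_leftI[of t] time) auto
      qed simp
    qed (use s time in auto)
    have "\<bar>It\<bar> \<le> b"
      using norm_blinfun[of "f' z" "(1, 0, 0)"] B1[OF \<open>z \<in> S\<close>] unfolding It_eq by (simp add: norm_Pair)
    have T1: "\<forall>s\<in>{t..T}. \<bar>I s x \<xi> - I t x \<xi> - (s - t) * It\<bar> \<le> B * (s - t)\<^sup>2 \<and>
          \<bar>I s x \<xi> - I t x \<xi>\<bar> \<le> B * (s - t)"
    proof
      fix s
      assume s: "s \<in> {t..T}"
      have "b * (s - t)\<^sup>2 \<le> B * (s - t)\<^sup>2"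
        using \<open>b \<le> B\<close> by (simp add: mult_right_mono)
      have "\<bar>(s - t) * It\<bar> \<le> (s - t) * b"
        unfolding abs_mult using s \<open>\<bar>It\<bar> \<le> b\<close> by (intro mult_mono) auto
      moreover have "b * (s - t)\<^sup>2 \<le> b * (T * (s - t))"
        unfolding power2_eq_square using s t \<open>b \<ge> 1\<close> by (intro mult_left_mono mult_right_mono) auto
      moreover have "(s - t) * b + b * (T * (s - t)) = B * (s - t)"
        by (simp add: B_def algebra_simps)
      ultimately have "\<bar>I s x \<xi> - I t x \<xi>\<bar> \<le> B * (s - t)"
        using time'[OF s] by linarith
      then show "\<bar>I s x \<xi> - I t x \<xi> - (s - t) * It\<bar> \<le> B * (s - t)\<^sup>2 \<and> \<bar>I s x \<xi> - I t x \<xi>\<bar> \<le> B * (s - t)"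
        using time'[OF s] \<open>b * (s - t)\<^sup>2 \<le> B * (s - t)\<^sup>2\<close> by linarith
    qed
    \<comment> \<open>The whole segment is required to stay in the domain; it may end on the inflow
      boundary, where the derivatives are one-sided.\<close>
    have S1: "\<bar>I t (y, x2) \<xi> - I t x \<xi> - (y - x1) * fst G\<bar> \<le> B * (y - x1)\<^sup>2"
      if "\<forall>w\<in>closed_segment x1 y. ((w, x2), \<xi>) \<in> ?D" for y
    proof -
      have "closed_segment z (t, (y, x2), \<theta>) \<subseteq> S"
        using t that by (auto simp: S_def z_def \<theta> x_def dest!: closed_segment_PairD)
      from taylor(2)[OF this]
      have "\<bar>f (t, (y, x2), \<theta>) - f z - f' z (0, (y - x1, 0), 0)\<bar> \<le> b * (norm (y - x1))\<^sup>2"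
        by (simp add: z_def x_def norm_Pair flip: zero_prod_def)
      moreover have "b * (norm (y - x1))\<^sup>2 \<le> B * (norm (y - x1))\<^sup>2"
        using \<open>b \<le> B\<close> by (simp add: mult_right_mono)
      ultimately show ?thesis
        unfolding G_eq by (simp add: f_def z_def \<theta> inner_prod_def)
    qed
    have S2: "\<bar>I t (x1, y) \<xi> - I t x \<xi> - (y - x2) * snd G\<bar> \<le> B * (y - x2)\<^sup>2"
      if "\<forall>w\<in>closed_segment x2 y. ((x1, w), \<xi>) \<in> ?D" for y
    proof -
      have "closed_segment z (t, (x1, y), \<theta>) \<subseteq> S"
        using t that by (auto simp: S_def z_def \<theta> x_def dest!: closed_segment_PairD)
      from taylor(2)[OF this]
      have "\<bar>f (t, (x1, y), \<theta>) - f z - f' z (0, (0, y - x2), 0)\<bar> \<le> b * (norm (y - x2))\<^sup>2"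
        by (simp add: z_def x_def norm_Pair flip: zero_prod_def)
      moreover have "b * (norm (y - x2))\<^sup>2 \<le> B * (norm (y - x2))\<^sup>2"
        using \<open>b \<le> B\<close> by (simp add: mult_right_mono)
      ultimately show ?thesis
        unfolding G_eq by (simp add: f_def z_def \<theta> inner_prod_def)
    qed
    have "\<xi> \<bullet> G = fst \<xi> * fst G + snd \<xi> * snd G"
      by (simp add: inner_prod_def)
    with pde T1 S1 S2 show "\<exists>It G1 G2.
        1 / c (x1, x2) * It = - (fst \<xi> * G1 + snd \<xi> * G2)
          - (\<mu>a (x1, x2) + \<mu>s (x1, x2)) * I t (x1, x2) \<xi>
          + \<mu>s (x1, x2) * circle_integral (\<lambda>\<xi>'. kernel pt (x1, x2) \<xi> \<xi>' * I t (x1, x2) \<xi>')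
          + q t (x1, x2) \<xi> \<and>
        (\<forall>s\<in>{t..T}. \<bar>I s (x1, x2) \<xi> - I t (x1, x2) \<xi> - (s - t) * It\<bar> \<le> B * (s - t)\<^sup>2 \<and>
          \<bar>I s (x1, x2) \<xi> - I t (x1, x2) \<xi>\<bar> \<le> B * (s - t)) \<and>
        (\<forall>y. (\<forall>z\<in>closed_segment x1 y. ((z, x2), \<xi>) \<in> ?D) \<longrightarrow>
          \<bar>I t (y, x2) \<xi> - I t (x1, x2) \<xi> - (y - x1) * G1\<bar> \<le> B * (y - x1)\<^sup>2) \<and>
        (\<forall>y. (\<forall>z\<in>closed_segment x2 y. ((x1, z), \<xi>) \<in> ?D) \<longrightarrow>
          \<bar>I t (x1, y) \<xi> - I t (x1, x2) \<xi> - (y - x2) * G2\<bar> \<le> B * (y - x2)\<^sup>2)"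
      unfolding x_def by (intro exI[of _ It] exI[of _ "fst G"] exI[of _ "snd G"]) simp
  next
    fix t x
    assume t: "t \<in> {0..<T}" and x: "x \<in> rect L1 L2"
    \<comment> \<open>At an interior point every direction is admissible, so the entire angular line
      lies in \<open>S\<close>.\<close>
    have in_S: "(t, x, \<theta>) \<in> S" for \<theta>
      using t x by (simp add: S_def phase_space_def)
    define J where "J \<theta> = f' (t, x, \<theta>) (0, 0, 1)" for \<theta>
    have "((\<lambda>\<theta>. I t x (dir \<theta>)) has_real_derivative J \<theta>) (at \<theta>)" for \<theta>
    proof -
      have "(f has_derivative f' (t, x, \<theta>)) (at (t, x, \<theta>) within range (\<lambda>\<theta>. (t, x, \<theta>)))"
        using D1[OF in_S] in_S by (meson has_derivative_subset image_subsetI)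
      then have "((\<lambda>\<theta>. f (t, x, \<theta>)) has_derivative (\<lambda>h. f' (t, x, \<theta>) (0, 0, h))) (at \<theta>)"
        by (rule has_derivative_in_compose[rotated]) (auto intro!: derivative_eq_intros simp: zero_prod_def)
      then have "((\<lambda>\<theta>. I t x (dir \<theta>)) has_vector_derivative J \<theta>) (at \<theta>)"
        by (simp add: has_vector_derivative_def f_def J_def scale)
      then show ?thesis
        by (simp add: has_real_derivative_iff_has_vector_derivative)
    qed
    moreover have "\<bar>I t x (dir \<theta>)\<bar> \<le> B" for \<theta>
      using B0[OF in_S, of \<theta>] \<open>b \<le> B\<close> by (simp add: f_def)
    moreover have "\<bar>J \<theta>\<bar> \<le> B" for \<theta>
      using norm_blinfun[of "f' (t, x, \<theta>)" "(0, 0, 1)"] B1[OF in_S, of \<theta>] \<open>b \<le> B\<close>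
      by (simp add: J_def norm_Pair)
    moreover have "\<bar>J \<theta> - J \<phi>\<bar> \<le> B * \<bar>\<theta> - \<phi>\<bar>" for \<theta> \<phi>
    proof -
      have "closed_segment (t, x, \<phi>) (t, x, \<theta>) \<subseteq> S"
        using in_S by (auto dest!: closed_segment_PairD)
      from taylor(1)[OF this] have "norm (f' (t, x, \<theta>) - f' (t, x, \<phi>)) \<le> b * \<bar>\<theta> - \<phi>\<bar>"
        by (simp add: norm_Pair)
      also have "\<dots> \<le> B * \<bar>\<theta> - \<phi>\<bar>"
        using \<open>b \<le> B\<close> by (simp add: mult_right_mono)
      finally show ?thesis
        using norm_blinfun[of "f' (t, x, \<theta>) - f' (t, x, \<phi>)" "(0, 0, 1)"]
        by (simp add: J_def norm_Pair blinfun.diff_left)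
    qed
    ultimately show "\<exists>J. (\<forall>\<theta>. ((\<lambda>\<theta>. I t x (dir \<theta>)) has_real_derivative J \<theta>) (at \<theta>)) \<and>
        (\<forall>\<theta>. \<bar>I t x (dir \<theta>)\<bar> \<le> B) \<and> (\<forall>\<theta>. \<bar>J \<theta>\<bar> \<le> B) \<and> (\<forall>\<theta> \<phi>. \<bar>J \<theta> - J \<phi>\<bar> \<le> B * \<bar>\<theta> - \<phi>\<bar>)"
      by blast
  qed
qed

section \<open>Convergence\<close>

text \<open>By integrality \<open>0 < i < M\<close> means \<open>1 \<le> i \<le> M - 1\<close>, so
  the neighbours of an interior grid point do not leave the closed rectangle.\<close>

lemma interior_grid_point:
  fixes i :: int
  assumes "M > 0" "L > 0" "0 < of_int i * (L / real M)" "of_int i * (L / real M) < L"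
  shows "L / real M \<le> of_int i * (L / real M)" "of_int i * (L / real M) + L / real M \<le> L"
proof -
  have pos: "L / real M > 0"
    using assms by simp
  have "i > 0"
    using zero_less_mult_pos2[OF assms(3) pos] by simp
  then have "1 * (L / real M) \<le> of_int i * (L / real M)"
    using pos by (intro mult_right_mono) auto
  then show "L / real M \<le> of_int i * (L / real M)"
    by simp
  have "of_int i * (L / real M) < real M * (L / real M)"
    using assms by simp
  then have "real_of_int i < real M"
    using pos by (simp only: mult_less_cancel_right_pos)
  then have "i < int M"
    by (metis of_int_less_iff of_int_of_nat_eq)
  then have "real_of_int i + 1 \<le> real M"
    by linarith
  then have "(of_int i + 1) * (L / real M) \<le> real M * (L / real M)"
    using pos by (intro mult_right_mono) auto
  then show "of_int i * (L / real M) + L / real M \<le> L"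
    using assms(1) by (simp add: distrib_right add_divide_distrib)
qed

lemma one_plus_power_le_exp:
  fixes \<kappa> h T :: real
  assumes "0 \<le> \<kappa>" "0 \<le> h" "real k * h \<le> T"
  shows "(1 + \<kappa> * h) ^ k \<le> exp (\<kappa> * T)"
proof -
  have "(1 + \<kappa> * h) ^ k \<le> exp (\<kappa> * h) ^ k"
    using assms by (intro power_mono) (auto simp: exp_ge_add_one_self)
  also have "\<dots> = exp (\<kappa> * (real k * h))"
    by (simp add: mult_ac flip: exp_of_nat_mult)
  also have "\<dots> \<le> exp (\<kappa> * T)"
    using assms by (simp add: mult_left_mono)
  finally show ?thesis .
qed

text \<open>Fixed mesh ratios are expressed by choosing \<open>C\<close> after \<open>r1\<close> and
  \<open>r2\<close> but before the grid, the time step and the numerical solution. The boundary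
  condition at time \<open>T\<close> is demanded only if some time level equals
  \<open>T\<close>.\<close>

theorem theorem2p4:
  fixes T L1 L2 r1 r2 :: real
    and c \<mu>a \<mu>s :: "real \<times> real \<Rightarrow> real"
    and pt :: "real \<times> real \<Rightarrow> real \<Rightarrow> real"
    and q I1 I :: "real \<Rightarrow> real \<times> real \<Rightarrow> real \<times> real \<Rightarrow> real"
    and I0 :: "real \<times> real \<Rightarrow> real \<times> real \<Rightarrow> real"
  assumes "T > 0" "L1 > 0" "L2 > 0"
    and "c \<in> borel_measurable (lebesgue_on (rect L1 L2))"
    and "\<mu>a \<in> borel_measurable (lebesgue_on (rect L1 L2))"
    and "\<mu>s \<in> borel_measurable (lebesgue_on (rect L1 L2))"
    and "\<forall>x\<in>rect L1 L2. c x > 0" "bdd_above (c ` rect L1 L2)"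
    and "\<forall>x\<in>rect L1 L2. \<mu>a x \<ge> 0" "\<forall>x\<in>rect L1 L2. \<mu>s x \<ge> 0"
    and "\<exists>x\<in>rect L1 L2. \<mu>s x \<noteq> 0"
    and "absorption_ratio (rect L1 L2) \<mu>a \<mu>s > 0"
    and "scattering_kernel (rect L1 L2) pt"
    and "admissible_source T L1 L2 q"
    and "admissible_initial L1 L2 I0"
    and "admissible_inflow T L1 L2 I1"
    and "\<exists>\<mu>a_max>0. \<forall>x\<in>rect L1 L2. 0 \<le> \<mu>a x \<and> \<mu>a x \<le> \<mu>a_max"
    and "\<exists>\<mu>s_max>0. \<forall>x\<in>rect L1 L2. 0 \<le> \<mu>s x \<and> \<mu>s x \<le> \<mu>s_max"
    and "solves_P T L1 L2 c \<mu>a \<mu>s pt q I0 I1 I"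
    and "bounded_C2_solution T L1 L2 I"
  shows "\<exists>C>0. \<forall>(M1::nat) (M2::nat) (M::nat) (dt::real) u.
    M1 > 0 \<and> M2 > 0 \<and> M > 0 \<and> dt > 0 \<and>
    dt / (L1 / real M1) = r1 \<and> dt / (L2 / real M2) = r2 \<and>
    (SUP x\<in>rect L1 L2. c x) * dt / (L1 / real M1)
      + (SUP x\<in>rect L1 L2. c x) * dt / (L2 / real M2) \<le> 1 \<and>
    kernel_norm2 (rect L1 L2) pt * (2 * pi / real M)\<^sup>2
      \<le> 12 / pi * absorption_ratio (rect L1 L2) \<mu>a \<mu>s \<and>
    (T / dt \<in> \<nat> \<longrightarrow> (\<forall>(x, \<xi>)\<in>inflow_boundary L1 L2. I T x \<xi> = I1 T x \<xi>)) \<and>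
    upwind_scheme T L1 L2 c \<mu>a \<mu>s pt q I0 I1 dt M1 M2 M u
    \<longrightarrow> (\<forall>k::nat. real k \<le> T / dt \<longrightarrow>
          grid_error L1 L2 M1 M2 M (I (real k * dt)) (u k)
            \<le> ennreal (C * (dt + (2 * pi / real M)\<^sup>2)))"
proof -
  let ?\<Omega> = "rect L1 L2"
  let ?D = "phase_space L1 L2 \<union> inflow_boundary L1 L2"
  note P = \<open>solves_P T L1 L2 c \<mu>a \<mu>s pt q I0 I1 I\<close>
  obtain \<mu>a_max where "\<mu>a_max > 0" and \<mu>a: "\<And>x. x \<in> ?\<Omega> \<Longrightarrow> 0 \<le> \<mu>a x \<and> \<mu>a x \<le> \<mu>a_max"
    using assms(17) by blast
  obtain \<mu>s_max where "\<mu>s_max > 0" and \<mu>s: "\<And>x. x \<in> ?\<Omega> \<Longrightarrow> 0 \<le> \<mu>s x \<and> \<mu>s x \<le> \<mu>s_max"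
    using assms(18) by blast
  define cm where "cm = (SUP x\<in>?\<Omega>. c x)"
  have c: "0 < c x" "c x \<le> cm" if "x \<in> ?\<Omega>" for x
    using assms(7,8) that by (auto simp: cm_def intro: cSUP_upper)
  have "cm > 0"
    using c assms(11) by (meson less_le_trans)
  obtain p where "p > 0"
    and ker: "\<And>x a b. x \<in> ?\<Omega> \<Longrightarrow> \<bar>kernel pt x (dir a) (dir b)\<bar> \<le> p"
    and quad: "\<And>x g g' B M n.
      \<lbrakk>x \<in> ?\<Omega>; M > 0; \<And>\<theta>. ((\<lambda>\<theta>. g (dir \<theta>)) has_real_derivative g' \<theta>) (at \<theta>);
       \<And>\<theta>. \<bar>g (dir \<theta>)\<bar> \<le> B; \<And>\<theta>. \<bar>g' \<theta>\<bar> \<le> B; \<And>\<theta> \<phi>. \<bar>g' \<theta> - g' \<phi>\<bar> \<le> B * \<bar>\<theta> - \<phi>\<bar>\<rbrakk> \<Longrightarrow>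
       \<bar>circle_integral (\<lambda>\<xi>'. kernel pt x (grid_dir M n) \<xi>' * g \<xi>')
         - 2 * pi / real M * (\<Sum>\<nu>\<in>{0..<int M}. kernel pt x (grid_dir M n) (grid_dir M \<nu>) * g (grid_dir M \<nu>))\<bar>
       \<le> p * B * (2 * pi / real M)\<^sup>2"
    using scattering_quadrature[OF assms(13)] by blast
  obtain B where "B > 0"
    and smooth: "\<And>t x1 x2 \<xi>. t \<in> {0..<T} \<Longrightarrow> ((x1, x2), \<xi>) \<in> phase_space L1 L2 \<Longrightarrow>
      \<exists>It G1 G2.
        1 / c (x1, x2) * It = - (fst \<xi> * G1 + snd \<xi> * G2)
          - (\<mu>a (x1, x2) + \<mu>s (x1, x2)) * I t (x1, x2) \<xi>
          + \<mu>s (x1, x2) * circle_integral (\<lambda>\<xi>'. kernel pt (x1, x2) \<xi> \<xi>' * I t (x1, x2) \<xi>')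
          + q t (x1, x2) \<xi> \<and>
        (\<forall>s\<in>{t..T}. \<bar>I s (x1, x2) \<xi> - I t (x1, x2) \<xi> - (s - t) * It\<bar> \<le> B * (s - t)\<^sup>2 \<and>
          \<bar>I s (x1, x2) \<xi> - I t (x1, x2) \<xi>\<bar> \<le> B * (s - t)) \<and>
        (\<forall>y. (\<forall>z\<in>closed_segment x1 y. ((z, x2), \<xi>) \<in> ?D) \<longrightarrow>
          \<bar>I t (y, x2) \<xi> - I t (x1, x2) \<xi> - (y - x1) * G1\<bar> \<le> B * (y - x1)\<^sup>2) \<and>
        (\<forall>y. (\<forall>z\<in>closed_segment x2 y. ((x1, z), \<xi>) \<in> ?D) \<longrightarrow>
          \<bar>I t (x1, y) \<xi> - I t (x1, x2) \<xi> - (y - x2) * G2\<bar> \<le> B * (y - x2)\<^sup>2)"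
    and angular: "\<And>t x. t \<in> {0..<T} \<Longrightarrow> x \<in> ?\<Omega> \<Longrightarrow>
      \<exists>J. (\<forall>\<theta>. ((\<lambda>\<theta>. I t x (dir \<theta>)) has_real_derivative J \<theta>) (at \<theta>)) \<and>
        (\<forall>\<theta>. \<bar>I t x (dir \<theta>)\<bar> \<le> B) \<and> (\<forall>\<theta>. \<bar>J \<theta>\<bar> \<le> B) \<and> (\<forall>\<theta> \<phi>. \<bar>J \<theta> - J \<phi>\<bar> \<le> B * \<bar>\<theta> - \<phi>\<bar>)"
    using solution_regularity[OF assms(1) P assms(20)] by blast
  define S where "S = \<mu>s_max + \<mu>a_max"
  \<comment> \<open>The growth rate is \<open>cm\<close> times the bound on the discrete scattering
    operator.\<close>
  define \<kappa> where "\<kappa> = cm * (\<mu>s_max * (2 * pi * p))"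
  \<comment> \<open>The summands stem, in this order, from the time difference, the upwind
    differences with mesh widths \<open>dt / r1\<close> and \<open>dt / r2\<close>, the angular
    quadrature and the time shift in the absorption term. The absolute values keep \<open>C1\<close>
    positive for arbitrary real \<open>r1\<close> and \<open>r2\<close>; for an actual grid both are
    positive.\<close>
  define C1 where "C1 = B + cm * (B * (1 / \<bar>r1\<bar> + 1 / \<bar>r2\<bar>) + \<mu>s_max * (p * B) + S * B)"
  define C where "C = T * C1 * exp (\<kappa> * T)"
  have "\<kappa> \<ge> 0" "S > 0"
    using \<open>cm > 0\<close> \<open>\<mu>s_max > 0\<close> \<open>\<mu>a_max > 0\<close> \<open>p > 0\<close> by (auto simp: \<kappa>_def S_def)
  have "C1 > 0"
    unfolding C1_def using \<open>cm > 0\<close> \<open>\<mu>s_max > 0\<close> \<open>S > 0\<close> \<open>p > 0\<close> \<open>B > 0\<close>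
    by (intro add_pos_nonneg mult_nonneg_nonneg add_nonneg_nonneg) auto
  then have "C > 0"
    using assms(1) by (simp add: C_def)
  have main: "grid_error L1 L2 M1 M2 M (I (real k * dt)) (u k) \<le> ennreal (C * (dt + (2 * pi / real M)\<^sup>2))"
    if "M1 > 0" "M2 > 0" "M > 0" "dt > 0"
      and ratio: "dt / (L1 / real M1) = r1" "dt / (L2 / real M2) = r2"
      and CFL: "cm * dt / (L1 / real M1) + cm * dt / (L2 / real M2) \<le> 1"
      and final: "T / dt \<in> \<nat> \<longrightarrow> (\<forall>(x, \<xi>)\<in>inflow_boundary L1 L2. I T x \<xi> = I1 T x \<xi>)"
      and scheme: "upwind_scheme T L1 L2 c \<mu>a \<mu>s pt q I0 I1 dt M1 M2 M u"
      and "real k \<le> T / dt"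
    for M1 M2 M :: nat and dt :: real and u k
  proof -
    define dx1 where "dx1 = L1 / real M1"
    define dx2 where "dx2 = L2 / real M2"
    have dx: "dx1 > 0" "dx2 > 0"
      using assms(2,3) \<open>M1 > 0\<close> \<open>M2 > 0\<close> by (auto simp: dx1_def dx2_def)
    define X where "X = grid_point dx1 dx2"
    define \<xi> where "\<xi> = grid_dir M"
    define h where "h = 2 * pi / real M"
    define w where "w k i j n = I (real k * dt) (X i j) (\<xi> n)" for k i j n
    define \<tau> where "\<tau> = C1 * (dt + h\<^sup>2)"
    define b where "b k = real k * dt * \<tau> * (1 + \<kappa> * dt) ^ k" for k
    have "\<tau> \<ge> 0"
      using \<open>C1 > 0\<close> \<open>dt > 0\<close> by (simp add: \<tau>_def)
    have "b k \<ge> 0" for k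
      using \<open>\<tau> \<ge> 0\<close> \<open>\<kappa> \<ge> 0\<close> \<open>dt > 0\<close> by (simp add: b_def)
    have eq: "1 / c (X i j) * ((u (Suc k) i j n - u k i j n) / dt) =
           A_grid dx1 dx2 M (u k) i j n - Sigma_grid dx1 dx2 \<mu>a \<mu>s (u (Suc k)) i j n
           + K_grid dx1 dx2 M \<mu>s pt (u k) i j n + q (real k * dt) (X i j) (\<xi> n)"
      if "real k \<le> T / dt - 1" "(X i j, \<xi> n) \<in> phase_space L1 L2" for k i j n
      using scheme that unfolding upwind_scheme_def Let_def dx1_def[symmetric] dx2_def[symmetric]
        X_def[symmetric] \<xi>_def[symmetric] by blast
    have init: "u 0 i j n = I0 (X i j) (\<xi> n)" if "(X i j, \<xi> n) \<in> phase_space L1 L2" for i j n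
      using scheme that unfolding upwind_scheme_def Let_def dx1_def[symmetric] dx2_def[symmetric]
        X_def[symmetric] \<xi>_def[symmetric] by blast
    have bdry: "u k i j n = I1 (real k * dt) (X i j) (\<xi> n)"
      if "real k \<le> T / dt" "(X i j, \<xi> n) \<in> inflow_boundary L1 L2" for k i j n
      using scheme that unfolding upwind_scheme_def Let_def dx1_def[symmetric] dx2_def[symmetric]
        X_def[symmetric] \<xi>_def[symmetric] by blast
    \<comment> \<open>Before \<open>T\<close> the boundary condition of the problem applies; at
      \<open>t = T\<close> the ratio \<open>T / dt\<close> is a natural number and
      \<open>final\<close> supplies it.\<close>
    have inflow: "w k i j n = u k i j n"
      if "real k \<le> T / dt" "(X i j, \<xi> n) \<in> inflow_boundary L1 L2" for k i j n
    proof (cases "real k * dt = T")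
      case True
      then have "T / dt = real k"
        using \<open>dt > 0\<close> by (simp add: field_simps)
      then have "T / dt \<in> \<nat>"
        by simp
      then show ?thesis
        using final that bdry[OF that] True by (auto simp: w_def)
    next
      case False
      then have "real k * dt \<in> {0..<T}"
        using that(1) \<open>dt > 0\<close> by (auto simp: field_simps)
      then show ?thesis
        using P that bdry[OF that] unfolding solves_P_def w_def by fastforce
    qed
    \<comment> \<open>The bound \<open>E\<close> at level \<open>k\<close> must also cover inflow
      points, as these can be upwind neighbours; only interior points are treated at the new
      level.\<close>
    have step: "\<bar>w (Suc k) i j n - u (Suc k) i j n\<bar> \<le> (1 + \<kappa> * dt) * E + dt * \<tau>"
      if k: "real (Suc k) \<le> T / dt" and X: "(X i j, \<xi> n) \<in> phase_space L1 L2"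
        and E: "\<And>i j n. (X i j, \<xi> n) \<in> ?D \<Longrightarrow> \<bar>w k i j n - u k i j n\<bar> \<le> E"
      for k i j n E
    proof -
      define t where "t = real k * dt"
      define x1 where "x1 = of_int i * dx1"
      define x2 where "x2 = of_int j * dx2"
      have x: "X i j = (x1, x2)"
        by (simp add: X_def grid_point_def x1_def x2_def)
      have nbr: "X (i - 1) j = (x1 - dx1, x2)" "X (i + 1) j = (x1 + dx1, x2)"
          "X i (j - 1) = (x1, x2 - dx2)" "X i (j + 1) = (x1, x2 + dx2)"
        by (simp_all add: X_def grid_point_def x1_def x2_def algebra_simps)
      have x_in: "(x1, x2) \<in> ?\<Omega>"
        using X by (simp add: x phase_space_def)
      then have bounds: "0 < x1" "x1 < L1" "0 < x2" "x2 < L2"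
        by (auto simp: rect_def)
      have stencil: "dx1 \<le> x1" "x1 + dx1 \<le> L1" "dx2 \<le> x2" "x2 + dx2 \<le> L2"
        using interior_grid_point[OF \<open>M1 > 0\<close> assms(2), of i] bounds(1,2)
          interior_grid_point[OF \<open>M2 > 0\<close> assms(3), of j] bounds(3,4)
        by (auto simp: x1_def x2_def dx1_def dx2_def)
      have X': "((x1, x2), \<xi> n) \<in> phase_space L1 L2"
        using X by (simp add: x)
      note upwind = upwind_segment[OF assms(2,3) X']
      have t1: "t + dt \<le> T"
        using k \<open>dt > 0\<close> by (simp add: t_def field_simps)
      \<comment> \<open>The equation is used only at the old time level, which precedes
        \<open>T\<close> even when the step ends there.\<close>
      have t0: "t \<in> {0..<T}"
        using t1 \<open>dt > 0\<close> by (simp add: t_def)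
      obtain It G1 G2 where
        pde: "1 / c (x1, x2) * It = - (fst (\<xi> n) * G1 + snd (\<xi> n) * G2)
          - (\<mu>a (x1, x2) + \<mu>s (x1, x2)) * I t (x1, x2) (\<xi> n)
          + \<mu>s (x1, x2) * circle_integral (\<lambda>\<xi>'. kernel pt (x1, x2) (\<xi> n) \<xi>' * I t (x1, x2) \<xi>')
          + q t (x1, x2) (\<xi> n)" and
        time: "\<And>s. s \<in> {t..T} \<Longrightarrow>
          \<bar>I s (x1, x2) (\<xi> n) - I t (x1, x2) (\<xi> n) - (s - t) * It\<bar> \<le> B * (s - t)\<^sup>2 \<and>
          \<bar>I s (x1, x2) (\<xi> n) - I t (x1, x2) (\<xi> n)\<bar> \<le> B * (s - t)" and
        space1: "\<And>y. (\<And>z. z \<in> closed_segment x1 y \<Longrightarrow> ((z, x2), \<xi> n) \<in> ?D) \<Longrightarrow>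
          \<bar>I t (y, x2) (\<xi> n) - I t (x1, x2) (\<xi> n) - (y - x1) * G1\<bar> \<le> B * (y - x1)\<^sup>2" and
        space2: "\<And>y. (\<And>z. z \<in> closed_segment x2 y \<Longrightarrow> ((x1, z), \<xi> n) \<in> ?D) \<Longrightarrow>
          \<bar>I t (x1, y) (\<xi> n) - I t (x1, x2) (\<xi> n) - (y - x2) * G2\<bar> \<le> B * (y - x2)\<^sup>2"
        using smooth[OF t0 X'] by blast
      have w_eq: "w k i' j' n' = I t (X i' j') (\<xi> n')" for i' j' n'
        by (simp add: w_def t_def)
      have advection: "\<bar>A_grid dx1 dx2 M (w k) i j n + (fst (\<xi> n) * G1 + snd (\<xi> n) * G2)\<bar>
          \<le> B * (dx1 + dx2)"
      proof (rule A_grid_consistent[OF dx])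
        show "\<bar>w k (i - 1) j n - w k i j n + dx1 * G1\<bar> \<le> B * dx1\<^sup>2" if "fst (\<xi> n) > 0"
          using space1[of "x1 - dx1"] upwind(1)[OF that] stencil bounds dx
          by (auto simp: w_eq x nbr closed_segment_eq_real_ivl)
        show "\<bar>w k (i + 1) j n - w k i j n - dx1 * G1\<bar> \<le> B * dx1\<^sup>2" if "fst (\<xi> n) < 0"
          using space1[of "x1 + dx1"] upwind(2)[OF that] stencil bounds dx
          by (auto simp: w_eq x nbr closed_segment_eq_real_ivl)
        show "\<bar>w k i (j - 1) n - w k i j n + dx2 * G2\<bar> \<le> B * dx2\<^sup>2" if "snd (\<xi> n) > 0"
          using space2[of "x2 - dx2"] upwind(3)[OF that] stencil bounds dx
          by (auto simp: w_eq x nbr closed_segment_eq_real_ivl)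
        show "\<bar>w k i (j + 1) n - w k i j n - dx2 * G2\<bar> \<le> B * dx2\<^sup>2" if "snd (\<xi> n) < 0"
          using space2[of "x2 + dx2"] upwind(4)[OF that] stencil bounds dx
          by (auto simp: w_eq x nbr closed_segment_eq_real_ivl)
      qed (use \<open>B > 0\<close> in \<open>auto simp: \<xi>_def\<close>)
      have stable: "\<bar>(w k i j n - u k i j n)
          + c (x1, x2) * dt * A_grid dx1 dx2 M (\<lambda>i j n. w k i j n - u k i j n) i j n\<bar> \<le> E"
      proof (rule A_grid_stable[OF dx])
        show "0 \<le> c (x1, x2) * dt"
          using c[OF x_in] \<open>dt > 0\<close> by simp
        have "c (x1, x2) * dt / dx1 \<le> cm * dt / dx1" "c (x1, x2) * dt / dx2 \<le> cm * dt / dx2"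
          using c[OF x_in] \<open>dt > 0\<close> dx by (auto intro!: divide_right_mono mult_right_mono)
        then show "c (x1, x2) * dt / dx1 + c (x1, x2) * dt / dx2 \<le> 1"
          using CFL unfolding dx1_def[symmetric] dx2_def[symmetric] by linarith
        show "\<bar>w k i j n - u k i j n\<bar> \<le> E"
          using E X by blast
        show "\<bar>w k (i - 1) j n - u k (i - 1) j n\<bar> \<le> E" if "fst (\<xi> n) > 0"
          using upwind(1)[OF that] stencil bounds dx by (intro E) (auto simp: nbr)
        show "\<bar>w k (i + 1) j n - u k (i + 1) j n\<bar> \<le> E" if "fst (\<xi> n) < 0"
          using upwind(2)[OF that] stencil bounds dx by (intro E) (auto simp: nbr)
        show "\<bar>w k i (j - 1) n - u k i (j - 1) n\<bar> \<le> E" if "snd (\<xi> n) > 0"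
          using upwind(3)[OF that] stencil bounds dx by (intro E) (auto simp: nbr)
        show "\<bar>w k i (j + 1) n - u k i (j + 1) n\<bar> \<le> E" if "snd (\<xi> n) < 0"
          using upwind(4)[OF that] stencil bounds dx by (intro E) (auto simp: nbr)
      qed (simp add: \<xi>_def)
      have \<mu>sx: "0 \<le> \<mu>s (x1, x2)" "\<mu>s (x1, x2) \<le> \<mu>s_max"
        using \<mu>s[OF x_in] by auto
      have "\<bar>K_grid dx1 dx2 M \<mu>s pt (\<lambda>i j n. w k i j n - u k i j n) i j n\<bar> \<le> \<mu>s_max * (2 * pi * p) * E"
      proof (rule K_grid_bound[OF \<open>M > 0\<close>])
        \<comment> \<open>The position is interior, so all directions at it belong to the phase
          space and \<open>E\<close> applies to each.\<close>
        show "\<bar>w k i j \<nu> - u k i j \<nu>\<bar> \<le> E" for \<nu>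
          using x_in by (intro E) (auto simp: x phase_space_def \<xi>_def grid_dir_def)
      qed (use \<mu>sx \<open>p > 0\<close> ker[OF x_in] x in \<open>simp_all add: X_def\<close>)
      then have scattering: "\<bar>K_grid dx1 dx2 M \<mu>s pt (w k) i j n - K_grid dx1 dx2 M \<mu>s pt (u k) i j n\<bar>
          \<le> \<mu>s_max * (2 * pi * p) * E"
        by (simp only: K_grid_diff)
      obtain J where J: "\<And>\<theta>. ((\<lambda>\<theta>. I t (x1, x2) (dir \<theta>)) has_real_derivative J \<theta>) (at \<theta>)"
        "\<And>\<theta>. \<bar>I t (x1, x2) (dir \<theta>)\<bar> \<le> B" "\<And>\<theta>. \<bar>J \<theta>\<bar> \<le> B" "\<And>\<theta> \<phi>. \<bar>J \<theta> - J \<phi>\<bar> \<le> B * \<bar>\<theta> - \<phi>\<bar>"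
        using angular[OF t0 x_in] by blast
      let ?Q = "circle_integral (\<lambda>\<xi>'. kernel pt (x1, x2) (\<xi> n) \<xi>' * I t (x1, x2) \<xi>')"
      let ?K = "h * (\<Sum>\<nu>\<in>{0..<int M}. kernel pt (x1, x2) (\<xi> n) (\<xi> \<nu>) * I t (x1, x2) (\<xi> \<nu>))"
      have "\<bar>?Q - ?K\<bar> \<le> p * B * h\<^sup>2"
        unfolding h_def \<xi>_def by (rule quad[OF x_in \<open>M > 0\<close> J])
      then have "\<bar>\<mu>s (x1, x2) * (?Q - ?K)\<bar> \<le> \<mu>s_max * (p * B * h\<^sup>2)"
        unfolding abs_mult using \<mu>sx by (intro mult_mono) auto
      moreover have "K_grid dx1 dx2 M \<mu>s pt (w k) i j n = \<mu>s (x1, x2) * ?K"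
        unfolding K_grid_def Let_def X_def[symmetric] \<xi>_def[symmetric] w_eq x h_def by simp
      ultimately have quadrature: "\<bar>\<mu>s (x1, x2) * ?Q - K_grid dx1 dx2 M \<mu>s pt (w k) i j n\<bar>
          \<le> \<mu>s_max * (p * B * h\<^sup>2)"
        by (simp add: right_diff_distrib)
      have w': "w (Suc k) i j n = I (t + dt) (x1, x2) (\<xi> n)"
        by (simp add: w_def x t_def algebra_simps)
      have "real k \<le> T / dt - 1"
        using k by simp
      have "\<bar>w (Suc k) i j n - u (Suc k) i j n\<bar> \<le> (1 + cm * (\<mu>s_max * (2 * pi * p)) * dt) * E
          + dt * (B * dt + cm * (B * (dx1 + dx2) + \<mu>s_max * (p * B * h\<^sup>2) + S * B * dt))"
      proof (rule error_step[OF \<open>dt > 0\<close> c[OF x_in]])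
        show "0 \<le> \<mu>a (x1, x2) + \<mu>s (x1, x2)" "\<mu>a (x1, x2) + \<mu>s (x1, x2) \<le> S"
          using \<mu>a[OF x_in] \<mu>s[OF x_in] by (auto simp: S_def)
        show "1 / c (x1, x2) * It = - (fst (\<xi> n) * G1 + snd (\<xi> n) * G2)
            - (\<mu>a (x1, x2) + \<mu>s (x1, x2)) * w k i j n + \<mu>s (x1, x2) * ?Q + q t (x1, x2) (\<xi> n)"
          using pde by (simp add: w_eq x)
        show "1 / c (x1, x2) * ((u (Suc k) i j n - u k i j n) / dt) = A_grid dx1 dx2 M (u k) i j n
            - (\<mu>a (x1, x2) + \<mu>s (x1, x2)) * u (Suc k) i j n
            + K_grid dx1 dx2 M \<mu>s pt (u k) i j n + q t (x1, x2) (\<xi> n)"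
          using eq[OF \<open>real k \<le> T / dt - 1\<close> X]
          unfolding Sigma_grid_def X_def[symmetric] x t_def[symmetric] by (simp add: add.commute)
        show "\<bar>w (Suc k) i j n - w k i j n - dt * It\<bar> \<le> B * dt\<^sup>2"
          "\<bar>w (Suc k) i j n - w k i j n\<bar> \<le> B * dt"
          using time[of "t + dt"] t1 \<open>dt > 0\<close> by (auto simp: w' w_eq x)
        show "\<bar>(w k i j n - u k i j n)
            + c (x1, x2) * dt * (A_grid dx1 dx2 M (w k) i j n - A_grid dx1 dx2 M (u k) i j n)\<bar> \<le> E"
          using stable by (simp only: A_grid_diff)
      qed (use \<open>B > 0\<close> advection quadrature scattering in auto)
      also have "\<dots> \<le> (1 + \<kappa> * dt) * E + dt * \<tau>"
      proof -
        have r: "dx1 = dt * (1 / \<bar>r1\<bar>)" "dx2 = dt * (1 / \<bar>r2\<bar>)"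
          unfolding ratio[symmetric] using assms(2,3) \<open>M1 > 0\<close> \<open>M2 > 0\<close> \<open>dt > 0\<close>
          by (simp_all add: dx1_def dx2_def)
        \<comment> \<open>Each defect term carries either \<open>dt\<close> or
          \<open>h\<^sup>2\<close>, while \<tau> multiplies all of them by
          \<open>dt + h\<^sup>2\<close>; the difference consists of the surplus products, which are
          nonnegative.\<close>
        have "\<tau> - (B * dt + cm * (B * (dx1 + dx2) + \<mu>s_max * (p * B * h\<^sup>2) + S * B * dt))
            = (B + cm * (B * (1 / \<bar>r1\<bar> + 1 / \<bar>r2\<bar>) + S * B)) * h\<^sup>2 + cm * (\<mu>s_max * (p * B)) * dt"
          unfolding \<tau>_def C1_def r by (simp only: algebra_simps)
        also have "\<dots> \<ge> 0"
          using \<open>B > 0\<close> \<open>cm > 0\<close> \<open>S > 0\<close> \<open>\<mu>s_max > 0\<close> \<open>p > 0\<close> \<open>dt > 0\<close>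
          by (intro add_nonneg_nonneg mult_nonneg_nonneg) auto
        finally have "B * dt + cm * (B * (dx1 + dx2) + \<mu>s_max * (p * B * h\<^sup>2) + S * B * dt) \<le> \<tau>"
          by simp
        then show ?thesis
          using \<open>dt > 0\<close> by (simp add: \<kappa>_def)
      qed
      finally show ?thesis .
    qed
    \<comment> \<open>Induction over time levels: interior errors follow \<open>step\<close>,
      whereas errors on the inflow boundary vanish at every level.\<close>
    have bound: "\<bar>w k i j n - u k i j n\<bar> \<le> b k" if "real k \<le> T / dt" "(X i j, \<xi> n) \<in> ?D" for k i j n
      using that
    proof (induction k arbitrary: i j n)
      case 0
      have "w 0 i j n = u 0 i j n"
      proof (cases "(X i j, \<xi> n) \<in> phase_space L1 L2")
        case True
        then show ?thesis
          using P init[OF True] unfolding solves_P_def w_def by fastforce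
      next
        case False
        then show ?thesis
          using inflow[of 0] 0 by auto
      qed
      then show ?case
        by (simp add: b_def)
    next
      case (Suc k)
      show ?case
      proof (cases "(X i j, \<xi> n) \<in> phase_space L1 L2")
        case True
        have "\<bar>w (Suc k) i j n - u (Suc k) i j n\<bar> \<le> (1 + \<kappa> * dt) * b k + dt * \<tau>"
          using Suc by (intro step True) auto
        also have "\<dots> \<le> b (Suc k)"
          unfolding b_def using \<open>\<kappa> \<ge> 0\<close> \<open>dt > 0\<close> \<open>\<tau> \<ge> 0\<close> by (intro discrete_gronwall) auto
        finally show ?thesis .
      next
        case False
        then show ?thesis
          using inflow[of "Suc k"] Suc.prems \<open>b (Suc k) \<ge> 0\<close> by auto
      qed
    qed
    have kT: "real k * dt \<le> T"
      using \<open>real k \<le> T / dt\<close> \<open>dt > 0\<close> by (simp add: field_simps)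
    \<comment> \<open>The bound \<open>real k * dt \<le> T\<close> is used twice, for the linear
      factor and for the power.\<close>
    have "b k \<le> T * \<tau> * exp (\<kappa> * T)"
      unfolding b_def using kT \<open>\<tau> \<ge> 0\<close> \<open>\<kappa> \<ge> 0\<close> \<open>dt > 0\<close> \<open>T > 0\<close>
      by (intro mult_mono one_plus_power_le_exp) auto
    also have "\<dots> = C * (dt + h\<^sup>2)"
      by (simp add: C_def \<tau>_def mult_ac)
    finally have "b k \<le> C * (dt + h\<^sup>2)" .
    then show ?thesis
      unfolding grid_error_def Let_def dx1_def[symmetric] dx2_def[symmetric] X_def[symmetric]
        \<xi>_def[symmetric] h_def[symmetric]
      using order_trans[OF bound[OF \<open>real k \<le> T / dt\<close>]]
      by (intro SUP_least) (auto simp: w_def intro!: ennreal_leI)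
  qed
  show ?thesis
    using \<open>C > 0\<close> main unfolding cm_def by (intro exI[of _ C]) blast
qed

end
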